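(* Suppose the loop $L=\mathsf{while}\ E\ \{B\}$ satisfies the following properties: (1) $B$ contains only increment and decrement statements ($X_k\mathrel{+}=1$, $X_k\mathrel{\dot-}=1$), probabilistic branching ($\mathsf{if}\ \mathsf{flip}(\rho)\ \{\dots\}\ \mathsf{else}\ \{\dots\}$) and $\mathsf{fail}$ (combined by sequential composition); (2) $E$ occurring guarantees that $X_1\ge a_1\land\dots\land X_n\ge a_n$, i.e. $\mathrm{Dirac}(\boldsymbol x)|_E=0$ for every $\boldsymbol x\in\mathbb{N}^n$ with $x_i<a_i$ for some $i$, where $a_i\in\mathbb{N}$ is the maximum number of decrements of $X_i$ in any program path through $B$; (3) there are real coefficients $\lambda_1,\dots,\lambda_n\ge0$ such that $$\mathbb{E}_{\boldsymbol X\sim[\![B]\!](\mathrm{Dirac}(\boldsymbol x)|_E)}\Big[\sum_{i=1}^n\lambda_iX_i\Big]<\sum_{i=1}^n\lambda_ix_i\quad\text{for all }\boldsymbol x\in\mathbb{N}^n\text{ with }x_i\ge a_i\ (i=1,\dots,n).$$ Then for any initial $\mathrm{EGD}(\mathbf{P},\boldsymbol\alpha)$ there is a pair $(\mathbf{Q},\boldsymbol\beta)$ with $\mathrm{EGD}(\mathbf{P},\boldsymbol\alpha)\mathrel{[\![L]\!]^{\mathsf{geo}}}\mathrm{EGD}(\mathbf{Q},\boldsymbol\beta)$.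
   Context: Language. Fix $n$ variables $X_1,\dots,X_n$ with values in $\mathbb{N}=\{0,1,2,\dots\}$. Programs $P$ and events $E$ are given by $P ::= \mathsf{skip} \mid P_1;P_2 \mid X_k := 0 \mid X_k \mathrel{+}= a \mid X_k \mathrel{\dot-}= 1 \mid \mathsf{if}\ E\ \{P_1\}\ \mathsf{else}\ \{P_2\} \mid \mathsf{while}\ E\ \{P_1\} \mid \mathsf{fail}$ and $E ::= X_k = a \mid \mathsf{flip}(\rho) \mid \lnot E_1 \mid E_1 \land E_2$, with literals $a \in \mathbb{N}$, $\rho \in [0,1]$. State space. $\mathbb{N}^n_\dagger := \mathbb{N}^n \cup \{\dagger\}$ where $\dagger$ is a failure state; all $\sigma$-algebras are discrete. For measures, $\mu \preceq \nu$ means $\mu(S)\le\nu(S)$ for all $S$; for measure transformers, $\phi \sqsubseteq \psi$ means $\phi(\mu)\preceq\psi(\mu)$ for all $\mu$. Write $\mu|_\dagger$ and $\mu|_{\mathbb{N}^n}$ for the restrictions of $\mu$ to $\{\dagger\}$ and $\mathbb{N}^n$; $\boldsymbol{x}[k\mapsto v]$ is $\boldsymbol{x}$ with $k$-th entry replaced by $v$; $x \mathbin{\dot-} 1 := \max(x-1,0)$. Measures on $\mathbb{N}^n$ are regarded as measures on $\mathbb{N}^n_\dagger$ with no mass on $\dagger$. For a measure $\mu$ on $\mathbb{N}^n$ (not necessarily a probability), $\mathbb{E}_{\boldsymbol X\sim\mu}[f(\boldsymbol X)]:=\sum_{\boldsymbol x}\mu(\boldsymbol x)f(\boldsymbol x)$.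 Event semantics. $\mu|_{X_k=a}(S) := \mu(\{\boldsymbol{x}\in S\cap\mathbb{N}^n : x_k=a\})$, $\mu|_{\mathsf{flip}(\rho)} := \rho\cdot\mu|_{\mathbb{N}^n}$, $\mu|_{\lnot E_1} := \mu|_{\mathbb{N}^n}-\mu|_{E_1}$, $\mu|_{E_1\land E_2} := (\mu|_{E_1})|_{E_2}$. Standard semantics $[\![P]\!]_\dagger : \mathrm{Meas}(\mathbb{N}^n_\dagger)\to\mathrm{Meas}(\mathbb{N}^n_\dagger)$: $[\![\mathsf{skip}]\!]_\dagger(\mu)=\mu$; $[\![P_1;P_2]\!]_\dagger(\mu)=[\![P_2]\!]_\dagger([\![P_1]\!]_\dagger(\mu))$; $[\![X_k:=0]\!]_\dagger(\mu)(S)=\mu|_\dagger(S)+\mu(\{\boldsymbol{x}\in\mathbb{N}^n : \boldsymbol{x}[k\mapsto 0]\in S\})$; $[\![X_k \mathrel{+}= a]\!]_\dagger(\mu)(S)=\mu|_\dagger(S)+\mu(\{\boldsymbol{x}\in\mathbb{N}^n : \boldsymbol{x}[k\mapsto x_k+a]\in S\})$; $[\![X_k \mathrel{\dot-}= 1]\!]_\dagger(\mu)(S)=\mu|_\dagger(S)+\mu(\{\boldsymbol{x}\in\mathbb{N}^n : \boldsymbol{x}[k\mapsto x_k\mathbin{\dot-}1]\in S\})$; $[\![\mathsf{if}\ E\ \{P_1\}\ \mathsf{else}\ \{P_2\}]\!]_\dagger(\mu)=\mu|_\dagger+[\![P_1]\!]_\dagger(\mu|_E)+[\![P_2]\!]_\dagger(\mu|_{\lnot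 E})$; $[\![\mathsf{fail}]\!]_\dagger(\mu)=\mu(\mathbb{N}^n_\dagger)\cdot\mathrm{Dirac}(\dagger)$; $[\![\mathsf{while}\ E\ \{P_1\}]\!]_\dagger$ is the least fixed point (w.r.t. $\sqsubseteq$) of $\Phi_{E,P_1}(\psi)(\mu) := \mu|_\dagger+\mu|_{\lnot E}+\psi([\![P_1]\!]_\dagger(\mu|_E))$. Simplified semantics: $[\![P]\!](\mu) := [\![P]\!]_\dagger(\mu)|_{\mathbb{N}^n}$ for $\mu\in\mathrm{Meas}(\mathbb{N}^n)$. Tensors and EGDs. $[d] := \{0,\dots,d-1\}$. A tensor $\mathbf{T}\in\mathbb{R}^{[d_1]\times\cdots\times[d_n]}$ (all $d_i\ge1$) has size $|\mathbf{T}|=(d_1,\dots,d_n)$, $|\mathbf{T}|_i=d_i$; $\mathbf{T}_{k:j}$ is the slice with $k$-th index fixed to $j$. Operations $\min,\max,+,-$ and relations $\le,<$ on vectors are componentwise; $\mathbf{0}_n,\mathbf{1}_n$ are the constant vectors; $\boldsymbol\alpha^{\boldsymbol i} := \prod_k\alpha_k^{i_k}$ with $0^0=1$; $[\varphi]$ is $1$ if $\varphi$ holds and $0$ otherwise. For a nonnegative tensor $\mathbf{P}$ and $\boldsymbol\alpha\in[0,1)^n$, $\mathrm{EGD}(\mathbf{P},\boldsymbol\alpha)$ is the measure on $\mathbb{N}^n$ with mass function $\boldsymbol i\mapsto\mathbf{P}_{\min(\boldsymbol i,|\mathbf{P}|-\mathbf{1}_n)}\cdot\boldsymbol\alpha^{\max(\boldsymbol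 i-|\mathbf{P}|+\mathbf{1}_n,\mathbf{0}_n)}$. An expansion of $\mathrm{EGD}(\mathbf{P},\boldsymbol\alpha)$ to a size $\boldsymbol s\ge|\mathbf{P}|$ is $\mathrm{EGD}(\mathbf{P}',\boldsymbol\alpha)$ with $|\mathbf{P}'|=\boldsymbol s$ and $\mathbf{P}'_{\boldsymbol i}=\mathbf{P}_{\min(\boldsymbol i,|\mathbf{P}|-\mathbf{1}_n)}\boldsymbol\alpha^{\max(\boldsymbol i-|\mathbf{P}|+\mathbf{1}_n,\mathbf{0}_n)}$ for $\boldsymbol i<\boldsymbol s$. The relations and operations below act on representations $(\mathbf{P},\boldsymbol\alpha)$, although written with $\mathrm{EGD}(\mathbf{P},\boldsymbol\alpha)$. Order: $\mathrm{EGD}(\mathbf{P},\boldsymbol\alpha)\preceq_{\mathsf{EGD}}\mathrm{EGD}(\mathbf{Q},\boldsymbol\beta)$ iff $\boldsymbol\alpha\le\boldsymbol\beta$ and for all $\boldsymbol i<\max(|\mathbf{P}|,|\mathbf{Q}|)$: $\mathbf{P}_{\min(\boldsymbol i,|\mathbf{P}|-\mathbf{1}_n)}\boldsymbol\alpha^{\max(\boldsymbol i-|\mathbf{P}|+\mathbf{1}_n,\mathbf{0}_n)}\le\mathbf{Q}_{\min(\boldsymbol i,|\mathbf{Q}|-\mathbf{1}_n)}\boldsymbol\beta^{\max(\boldsymbol i-|\mathbf{Q}|+\mathbf{1}_n,\mathbf{0}_n)}$. Join: $(\mathrm{EGD}(\mathbf{R},\boldsymbol\gamma),\mathrm{EGD}(\mathbf{S},\boldsymbol\delta),\mathrm{EGD}(\mathbf{Q},\boldsymbol\beta))\in\mathsf{Join}$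 iff $\boldsymbol\gamma\le\boldsymbol\beta$, $\boldsymbol\delta\le\boldsymbol\beta$ and there are expansions $\mathrm{EGD}(\mathbf{R}',\boldsymbol\gamma)$, $\mathrm{EGD}(\mathbf{S}',\boldsymbol\delta)$ of the first two, of the same size, with $\mathbf{Q}=\mathbf{R}'+\mathbf{S}'$. Geometric event semantics $\mathrm{EGD}(\mathbf{P},\boldsymbol\alpha)|^{\mathsf{geo}}_E$: for $X_k=a$: $\mathrm{EGD}(\mathbf{Q},\boldsymbol\alpha[k\mapsto0])$ with $|\mathbf{Q}|=|\mathbf{P}|[k\mapsto\max(|\mathbf{P}|_k,a+2)]$, $\mathbf{Q}_{k:j}=\mathbf{P}_{k:\min(j,|\mathbf{P}|_k-1)}\cdot\alpha_k^{\max(0,j-|\mathbf{P}|_k+1)}\cdot[j=a]$; for $\mathsf{flip}(\rho)$: $\mathrm{EGD}(\rho\mathbf{P},\boldsymbol\alpha)$; for $\lnot E_1$: $\mathrm{EGD}(\mathbf{Q},\boldsymbol\alpha)$ where $\mathrm{EGD}(\mathbf{P},\boldsymbol\alpha)|^{\mathsf{geo}}_{E_1}=\mathrm{EGD}(\mathbf{R},\boldsymbol\gamma)$, $|\mathbf{Q}|=|\mathbf{R}|$, $\mathbf{Q}_{\boldsymbol i}=\mathbf{P}_{\min(\boldsymbol i,|\mathbf{P}|-\mathbf{1}_n)}\boldsymbol\alpha^{\max(\boldsymbol i-|\mathbf{P}|+\mathbf{1}_n,\mathbf{0}_n)}-\mathbf{R}_{\boldsymbol i}$ for $\boldsymbol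 i<|\mathbf{Q}|$; for $E_1\land E_2$: $(\mathrm{EGD}(\mathbf{P},\boldsymbol\alpha)|^{\mathsf{geo}}_{E_1})|^{\mathsf{geo}}_{E_2}$. Geometric bound semantics: the relation $\mathrm{EGD}(\mathbf{P},\boldsymbol\alpha)\mathrel{[\![P]\!]^{\mathsf{geo}}}\mathrm{EGD}(\mathbf{Q},\boldsymbol\beta)$ holds iff: - $\mathsf{skip}$: $\boldsymbol\beta=\boldsymbol\alpha$, $\mathbf{Q}=\mathbf{P}$. - $P_1;P_2$: there are $\mathbf{R},\boldsymbol\gamma$ with $\mathrm{EGD}(\mathbf{P},\boldsymbol\alpha)\mathrel{[\![P_1]\!]^{\mathsf{geo}}}\mathrm{EGD}(\mathbf{R},\boldsymbol\gamma)$ and $\mathrm{EGD}(\mathbf{R},\boldsymbol\gamma)\mathrel{[\![P_2]\!]^{\mathsf{geo}}}\mathrm{EGD}(\mathbf{Q},\boldsymbol\beta)$. - $X_k:=0$: $\boldsymbol\beta=\boldsymbol\alpha[k\mapsto0]$, $|\mathbf{Q}|=|\mathbf{P}|[k\mapsto2]$, $\mathbf{Q}_{k:0}=\frac{\mathbf{P}_{k:|\mathbf{P}|_k-1}}{1-\alpha_k}+\sum_{j=0}^{|\mathbf{P}|_k-2}\mathbf{P}_{k:j}$, $\mathbf{Q}_{k:1}=0$. - $X_k\mathrel{+}=a$: $\boldsymbol\beta=\boldsymbol\alpha$, $|\mathbf{Q}|=|\mathbf{P}|[k\mapsto|\mathbf{P}|_k+a]$, $\mathbf{Q}_{k:j}=0$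 for $j<a$ and $\mathbf{Q}_{k:j}=\mathbf{P}_{k:j-a}$ otherwise. - $X_k\mathrel{\dot-}=1$: $\boldsymbol\beta=\boldsymbol\alpha$, $|\mathbf{Q}|=|\mathbf{P}|[k\mapsto\max(|\mathbf{P}|_k-1,2)]$, $\mathbf{Q}_{k:0}=\mathbf{P}_{k:0}+\mathbf{P}_{k:\min(|\mathbf{P}|_k-1,1)}\alpha_k^{\max(2-|\mathbf{P}|_k,0)}$ and $\mathbf{Q}_{k:j}=\mathbf{P}_{k:\min(|\mathbf{P}|_k-1,j+1)}\alpha_k^{\max(j+2-|\mathbf{P}|_k,0)}$ for $j\ge1$. - $\mathsf{if}\ E\ \{P_1\}\ \mathsf{else}\ \{P_2\}$: there are $\mathbf{R},\mathbf{S},\boldsymbol\gamma,\boldsymbol\delta$ with $\mathrm{EGD}(\mathbf{P},\boldsymbol\alpha)|^{\mathsf{geo}}_E\mathrel{[\![P_1]\!]^{\mathsf{geo}}}\mathrm{EGD}(\mathbf{R},\boldsymbol\gamma)$, $\mathrm{EGD}(\mathbf{P},\boldsymbol\alpha)|^{\mathsf{geo}}_{\lnot E}\mathrel{[\![P_2]\!]^{\mathsf{geo}}}\mathrm{EGD}(\mathbf{S},\boldsymbol\delta)$ and $(\mathrm{EGD}(\mathbf{R},\boldsymbol\gamma),\mathrm{EGD}(\mathbf{S},\boldsymbol\delta),\mathrm{EGD}(\mathbf{Q},\boldsymbol\beta))\in\mathsf{Join}$. - $\mathsf{while}\ E\ \{B\}$: there are $c\in[0,1)$, $\mathbf{R},\mathbf{S},\boldsymbol\gamma,\boldsymbol\delta$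 with $\mathrm{EGD}(\mathbf{P},\boldsymbol\alpha)\preceq_{\mathsf{EGD}}\mathrm{EGD}(\mathbf{R},\boldsymbol\gamma)$, $\mathrm{EGD}(\mathbf{R},\boldsymbol\gamma)|^{\mathsf{geo}}_E\mathrel{[\![B]\!]^{\mathsf{geo}}}\mathrm{EGD}(\mathbf{S},\boldsymbol\delta)$, $\mathrm{EGD}(\mathbf{S},\boldsymbol\delta)\preceq_{\mathsf{EGD}}\mathrm{EGD}(c\,\mathbf{R},\boldsymbol\gamma)$ and $\mathrm{EGD}(\frac{\mathbf{R}}{1-c},\boldsymbol\gamma)|^{\mathsf{geo}}_{\lnot E}=\mathrm{EGD}(\mathbf{Q},\boldsymbol\beta)$. - $\mathsf{fail}$: $\boldsymbol\beta=\mathbf{0}_n$, $\mathbf{Q}$ is the zero tensor of size $(1,\dots,1)$. *)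

theory Defs
  imports "HOL-Probability.Probability"
begin

(* The program variables are indexed by a finite type 'n, so n = CARD('n) and N^n is 'n => nat;
   vectors are ordered componentwise by the order on functions, and x[k |-> v] is x(k := v). *)

section \<open>Programs\<close>

datatype 'n event = VarEq 'n nat | Flip real | Neg "'n event" | Conj "'n event" "'n event"

datatype 'n prog =
    Skip
  | Seq "'n prog" "'n prog"
  | SetZero 'n
  | Inc 'n nat
  | Dec 'n
  | Ite "'n event" "'n prog" "'n prog"
  | While "'n event" "'n prog"
  | Fail

primrec wf_event :: "'n event \<Rightarrow> bool" where
  "wf_event (VarEq k a) = True"
| "wf_event (Flip \<rho>) = (0 \<le> \<rho> \<and> \<rho> \<le> 1)"
| "wf_event (Neg E) = wf_event E"
| "wf_event (Conj E1 E2) = (wf_event E1 \<and> wf_event E2)"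

primrec wf_prog :: "'n prog \<Rightarrow> bool" where
  "wf_prog Skip = True"
| "wf_prog (Seq P1 P2) = (wf_prog P1 \<and> wf_prog P2)"
| "wf_prog (SetZero k) = True"
| "wf_prog (Inc k a) = True"
| "wf_prog (Dec k) = True"
| "wf_prog (Ite E P1 P2) = (wf_event E \<and> wf_prog P1 \<and> wf_prog P2)"
| "wf_prog (While E P) = (wf_event E \<and> wf_prog P)"
| "wf_prog Fail = True"

section \<open>Standard semantics\<close>

(* None is the failure state.  Measures on the discrete state space are the measures M with
   sets M = UNIV (hence space M = UNIV); on these the library order on measures is the setwise
   one, see le_disc_measure_iff below. *)
type_synonym 'n state = "('n \<Rightarrow> nat) option"

abbreviation disc_measure :: "'a measure \<Rightarrow> bool" where
  "disc_measure M \<equiv> sets M = UNIV"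

definition disc :: "('a set \<Rightarrow> ennreal) \<Rightarrow> 'a measure" where
  "disc f = measure_of UNIV UNIV f"

definition restr :: "'a measure \<Rightarrow> 'a set \<Rightarrow> 'a measure" where
  "restr M A = density M (indicator A)"

abbreviation on_fail :: "'n state measure \<Rightarrow> 'n state measure" where
  "on_fail M \<equiv> restr M {None}"

abbreviation on_nat :: "'n state measure \<Rightarrow> 'n state measure" where
  "on_nat M \<equiv> restr M (range Some)"

definition dirac :: "('n \<Rightarrow> nat) \<Rightarrow> 'n state measure" where
  "dirac x = return (count_space UNIV) (Some x)"

(* The difference of measures in the negation clause is only meaningful for finite measures. *)
primrec event_sem :: "'n event \<Rightarrow> 'n state measure \<Rightarrow> 'n state measure" where
  "event_sem (VarEq k a) M = disc (\<lambda>S. emeasure M {Some x | x. Some x \<in> S \<and> x k = a})"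
| "event_sem (Flip \<rho>) M = scale_measure (ennreal \<rho>) (on_nat M)"
| "event_sem (Neg E) M = diff_measure (on_nat M) (event_sem E M)"
| "event_sem (Conj E1 E2) M = event_sem E2 (event_sem E1 M)"

definition while_step :: "'n event \<Rightarrow> ('n state measure \<Rightarrow> 'n state measure) \<Rightarrow>
    ('n state measure \<Rightarrow> 'n state measure) \<Rightarrow> 'n state measure \<Rightarrow> 'n state measure" where
  "while_step E body \<psi> M =
     disc (\<lambda>S. emeasure (on_fail M) S + emeasure (event_sem (Neg E) M) S
              + emeasure (\<psi> (body (event_sem E M))) S)"

primrec prog_sem :: "'n prog \<Rightarrow> 'n state measure \<Rightarrow> 'n state measure" where
  "prog_sem Skip M = M"
| "prog_sem (Seq P1 P2) M = prog_sem P2 (prog_sem P1 M)"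
| "prog_sem (SetZero k) M =
     disc (\<lambda>S. emeasure (on_fail M) S + emeasure M {Some x | x. Some (x(k := 0)) \<in> S})"
| "prog_sem (Inc k a) M =
     disc (\<lambda>S. emeasure (on_fail M) S + emeasure M {Some x | x. Some (x(k := x k + a)) \<in> S})"
| "prog_sem (Dec k) M =
     disc (\<lambda>S. emeasure (on_fail M) S + emeasure M {Some x | x. Some (x(k := x k - 1)) \<in> S})"
| "prog_sem (Ite E P1 P2) M =
     disc (\<lambda>S. emeasure (on_fail M) S + emeasure (prog_sem P1 (event_sem E M)) S
              + emeasure (prog_sem P2 (event_sem (Neg E) M)) S)"
| "prog_sem (While E P) M = lfp (while_step E (prog_sem P)) M"
| "prog_sem Fail M = scale_measure (emeasure M UNIV) (return (count_space UNIV) None)"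

definition nat_sem :: "'n prog \<Rightarrow> 'n state measure \<Rightarrow> 'n state measure" where
  "nat_sem P M = on_nat (prog_sem P M)"

(* The sum over all x of M(x) f(x), as an extended nonnegative real. *)
definition expect :: "'n state measure \<Rightarrow> (('n \<Rightarrow> nat) \<Rightarrow> real) \<Rightarrow> ennreal" where
  "expect M f = (\<integral>\<^sup>+ x. emeasure M {Some x} * ennreal (f x) \<partial>count_space UNIV)"

subsection \<open>Sanity checks on the standard semantics\<close>

lemma sets_disc [simp]: "sets (disc f) = UNIV" and space_disc [simp]: "space (disc f) = UNIV"
  unfolding disc_def by (auto simp: sets_measure_of_conv intro: sigma_sets.Basic)

lemma space_disc_measure: "disc_measure M \<Longrightarrow> space M = UNIV"
  by (metis UNIV_I sets.top top.extremum_uniqueI sets.sets_into_space)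

lemma le_disc_measure_iff:
  "disc_measure M \<Longrightarrow> disc_measure N \<Longrightarrow> M \<le> N \<longleftrightarrow> (\<forall>S. emeasure M S \<le> emeasure N S)"
  by (simp add: le_measure le_fun_def)

lemma emeasure_disc_add:
  assumes "disc_measure M" "disc_measure N"
  shows "emeasure (disc (\<lambda>S. emeasure M S + emeasure N S)) S = emeasure M S + emeasure N S"
proof -
  have "countably_additive UNIV (\<lambda>S. emeasure M S + emeasure N S)"
    using emeasure_countably_additive[of M] emeasure_countably_additive[of N] assms
    by (auto simp: countably_additive_def suminf_add[symmetric])
  then have "measure_space UNIV UNIV (\<lambda>S. emeasure M S + emeasure N S)"
    unfolding measure_space_def
    by (metis (no_types, lifting) add.right_neutral assms(1) emeasure_empty positive_def
        sets.sigma_algebra_axioms space_disc_measure)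
  then show ?thesis
    unfolding disc_def by (intro emeasure_measure_of_sigma)
      (auto simp: measure_space_def)
qed

lemma emeasure_restr: "disc_measure M \<Longrightarrow> emeasure (restr M A) S = emeasure M (A \<inter> S)"
  unfolding restr_def by (simp add: emeasure_restricted)

lemma sets_restr [simp]: "sets (restr M A) = sets M"
  by (simp add: restr_def)

lemma disc_measure_event_sem: "disc_measure M \<Longrightarrow> disc_measure (event_sem E M)"
  by (induction E arbitrary: M) auto

lemma emeasure_while_step:
  assumes "disc_measure M" "disc_measure (\<psi> (body (event_sem E M)))"
  shows "emeasure (while_step E body \<psi> M) S =
    emeasure (on_fail M) S + emeasure (event_sem (Neg E) M) S
      + emeasure (\<psi> (body (event_sem E M))) S"
proof -
  have *: "disc_measure (on_fail M)" "disc_measure (event_sem (Neg E) M)"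
    using assms by auto
  show ?thesis
    unfolding while_step_def
    using emeasure_disc_add[of "disc (\<lambda>S. emeasure (on_fail M) S + emeasure (event_sem (Neg E) M) S)"]
      emeasure_disc_add[OF *] assms(2) by simp
qed

lemma disc_measure_le:
  assumes "disc_measure M" "M \<le> N"
  shows "disc_measure N"
proof -
  have M: "space M = UNIV" using assms(1) by (rule space_disc_measure)
  have N: "space N = UNIV" "sets N = UNIV \<or> UNIV \<subseteq> sets N"
    using assms(2) unfolding le_measure_iff M assms(1) by (metis top.extremum_uniqueI)+
  then show ?thesis by blast
qed

lemma disc_measure_while_step: "disc_measure (while_step E body \<psi> M)"
  by (simp only: while_step_def sets_disc)

lemma while_step_mono:
  assumes M: "disc_measure M" and d: "disc_measure (\<psi> (body (event_sem E M)))"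
    and le: "\<psi> (body (event_sem E M)) \<le> \<psi>' (body (event_sem E M))"
  shows "while_step E body \<psi> M \<le> while_step E body \<psi>' M"
proof -
  have d': "disc_measure (\<psi>' (body (event_sem E M)))"
    using d le by (rule disc_measure_le)
  have "emeasure (\<psi> (body (event_sem E M))) S \<le> emeasure (\<psi>' (body (event_sem E M))) S" for S
    using le le_disc_measure_iff[OF d d'] by blast
  then have "emeasure (while_step E body \<psi> M) S \<le> emeasure (while_step E body \<psi>' M) S" for S
    unfolding emeasure_while_step[where \<psi>=\<psi> and body=body and E=E, OF M d]
      emeasure_while_step[where \<psi>=\<psi>' and body=body and E=E, OF M d']
    by (rule add_left_mono)
  then show ?thesis
    using le_disc_measure_iff[OF disc_measure_while_step disc_measure_while_step] by blast
qed

lemma prefix_disc_measure: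
  assumes "while_step E body u \<le> u"
  shows "disc_measure (u M)"
  using disc_measure_while_step le_funD[OF assms] by (rule disc_measure_le)

lemma disc_measure_lfp: "disc_measure (lfp (while_step E body) M)"
proof -
  let ?z = "null_measure (count_space UNIV) :: 'a state measure"
  have z: "disc_measure ?z" by simp
  have "(\<lambda>_. ?z) \<le> lfp (while_step E body)"
  proof (rule lfp_greatest, rule le_funI)
    fix u and M :: "'a state measure" assume "while_step E body u \<le> u"
    then have u: "disc_measure (u M)" by (rule prefix_disc_measure)
    show "?z \<le> u M"
      unfolding le_disc_measure_iff[OF z u] by simp
  qed
  from z le_funD[OF this] show ?thesis by (rule disc_measure_le)
qed

lemma while_lfp_least:
  assumes body: "\<And>M. disc_measure M \<Longrightarrow> disc_measure (body M)"
    and \<psi>: "\<And>M. disc_measure M \<Longrightarrow> disc_measure (\<psi> M)"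
    and pre: "\<And>M. disc_measure M \<Longrightarrow> while_step E body \<psi> M \<le> \<psi> M"
    and M: "disc_measure M"
  shows "lfp (while_step E body) M \<le> \<psi> M"
proof -
  define u where "u = (\<lambda>M. if disc_measure M then \<psi> M else top)"
  have "while_step E body u \<le> u"
  proof (rule le_funI)
    fix M :: "'a state measure"
    show "while_step E body u M \<le> u M"
    proof (cases "disc_measure M")
      case True
      then have "disc_measure (body (event_sem E M))"
        by (intro body disc_measure_event_sem)
      then have "u (body (event_sem E M)) = \<psi> (body (event_sem E M))"
        by (simp add: u_def)
      then have "while_step E body u M = while_step E body \<psi> M"
        by (simp add: while_step_def)
      with pre[OF True] True show ?thesis by (simp add: u_def)
    qed (simp add: u_def)
  qed
  then have "lfp (while_step E body) M \<le> u M"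
    by (intro le_funD[where f="lfp (while_step E body)"] lfp_lowerbound)
  with M show ?thesis by (simp add: u_def)
qed

lemma while_lfp_fixpoint:
  assumes body: "\<And>M. disc_measure M \<Longrightarrow> disc_measure (body M)"
    and M: "disc_measure M"
  shows "while_step E body (lfp (while_step E body)) M = lfp (while_step E body) M"
proof -
  let ?F = "while_step E body"
  have le: "?F (lfp ?F) M \<le> lfp ?F M" if "disc_measure M" for M
  proof -
    have "?F (lfp ?F) M \<le> u M" if u: "?F u \<le> u" for u
    proof -
      have "?F (lfp ?F) M \<le> ?F u M"
        using \<open>disc_measure M\<close> disc_measure_lfp le_funD[OF lfp_lowerbound[where f="?F" and A=u, OF u]]
        by (rule while_step_mono)
      also have "\<dots> \<le> u M" using u by (rule le_funD)
      finally show ?thesis .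
    qed
    then show ?thesis
      unfolding lfp_def[of ?F] Inf_apply by (intro INF_greatest) auto
  qed
  have "lfp ?F M \<le> ?F (lfp ?F) M"
  proof (rule while_lfp_least[OF body _ _ M])
    fix M :: "'a state measure" assume M: "disc_measure M"
    show "disc_measure (?F (lfp ?F) M)" by (simp add: while_step_def)
    have "disc_measure (body (event_sem E M))" using M by (intro body disc_measure_event_sem)
    from le[OF this] show "?F (?F (lfp ?F)) M \<le> ?F (lfp ?F) M"
      by (intro while_step_mono[OF M]) (auto simp: while_step_def)
  qed
  with le[OF M] show ?thesis by (rule antisym)
qed

lemma disc_measure_prog_sem: "disc_measure M \<Longrightarrow> disc_measure (prog_sem P M)"
proof (induction P arbitrary: M)
  case (While E P)
  show ?case by (simp only: prog_sem.simps disc_measure_lfp)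
qed simp_all

theorem prog_sem_While:
  assumes "disc_measure M"
  shows "prog_sem (While E P) M = while_step E (prog_sem P) (prog_sem (While E P)) M"
    and "\<lbrakk>\<And>N. disc_measure N \<Longrightarrow> disc_measure (\<psi> N);
          \<And>N. disc_measure N \<Longrightarrow> while_step E (prog_sem P) \<psi> N = \<psi> N\<rbrakk>
         \<Longrightarrow> prog_sem (While E P) M \<le> \<psi> M"
proof -
  have "prog_sem (While E P) = lfp (while_step E (prog_sem P))" by auto
  then show "prog_sem (While E P) M = while_step E (prog_sem P) (prog_sem (While E P)) M"
    using while_lfp_fixpoint[where body="prog_sem P" and E=E, OF disc_measure_prog_sem assms]
    by simp
  show "prog_sem (While E P) M \<le> \<psi> M"
    if "\<And>N. disc_measure N \<Longrightarrow> disc_measure (\<psi> N)"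
      "\<And>N. disc_measure N \<Longrightarrow> while_step E (prog_sem P) \<psi> N = \<psi> N"
    using while_lfp_least[where body="prog_sem P" and E=E and \<psi>=\<psi>,
        OF disc_measure_prog_sem that(1) _ assms] that(2) by simp
qed

lemma emeasure_disc_push:
  assumes "disc_measure M"
  shows "emeasure (disc (\<lambda>S. emeasure (on_fail M) S + emeasure M {Some x | x. Some (g x) \<in> S})) S
    = emeasure (on_fail M) S + emeasure M {Some x | x. Some (g x) \<in> S}"
proof -
  define N where "N = distr (on_nat M) (count_space UNIV) (map_option g)"
  have "emeasure N S = emeasure M {Some x | x. Some (g x) \<in> S}" for S
  proof -
    have "emeasure N S = emeasure M (range Some \<inter> map_option g -` S)"
      using assms unfolding N_def
      by (subst emeasure_distr) (auto simp: emeasure_restr space_disc_measure measurable_def)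
    also have "range Some \<inter> map_option g -` S = {Some x | x. Some (g x) \<in> S}" by auto
    finally show ?thesis .
  qed
  moreover have "disc_measure N" by (simp add: N_def)
  ultimately show ?thesis
    using emeasure_disc_add[of "on_fail M" N] assms by simp
qed

lemma emeasure_event_VarEq:
  assumes "disc_measure M"
  shows "emeasure (event_sem (VarEq k a) M) S = emeasure M {Some x | x. Some x \<in> S \<and> x k = a}"
proof -
  let ?N = "restr M {Some x | x. x k = a}"
  have eq: "emeasure M {Some x | x. Some x \<in> S \<and> x k = a} = emeasure ?N S" for S
  proof -
    have "{Some x | x. Some x \<in> S \<and> x k = a} = {Some x | x. x k = a} \<inter> S" by auto
    then show ?thesis using assms by (simp add: emeasure_restr)
  qed
  have "emeasure (disc (\<lambda>S. emeasure ?N S + emeasure (null_measure ?N) S)) S = emeasure ?N S"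
    using assms by (subst emeasure_disc_add) auto
  then show ?thesis by (simp add: eq)
qed

section \<open>Program paths\<close>

(* A path is the list of atomic commands executed; fail aborts, so nothing follows it. *)
definition seq_paths :: "'n prog list set \<Rightarrow> 'n prog list set \<Rightarrow> 'n prog list set" where
  "seq_paths A C = {p \<in> A. Fail \<in> set p} \<union> {p @ q | p q. p \<in> A \<and> Fail \<notin> set p \<and> q \<in> C}"

primrec paths :: "'n prog \<Rightarrow> 'n prog list set" where
  "paths Skip = {[Skip]}"
| "paths (Seq P1 P2) = seq_paths (paths P1) (paths P2)"
| "paths (SetZero k) = {[SetZero k]}"
| "paths (Inc k a) = {[Inc k a]}"
| "paths (Dec k) = {[Dec k]}"
| "paths (Ite E P1 P2) = paths P1 \<union> paths P2"
| "paths (While E P) = (\<Union>m. (seq_paths (paths P) ^^ m) {[]})"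
| "paths Fail = {[Fail]}"

definition max_decs :: "'n prog \<Rightarrow> 'n \<Rightarrow> nat" where
  "max_decs P k = Max ((\<lambda>p. count_list p (Dec k)) ` paths P)"

inductive simple_body :: "'n prog \<Rightarrow> bool" where
  "simple_body (Inc k 1)"
| "simple_body (Dec k)"
| "simple_body Fail"
| "simple_body P1 \<Longrightarrow> simple_body P2 \<Longrightarrow> simple_body (Ite (Flip \<rho>) P1 P2)"
| "simple_body P1 \<Longrightarrow> simple_body P2 \<Longrightarrow> simple_body (Seq P1 P2)"

lemma finite_paths_simple_body:
  "simple_body P \<Longrightarrow> finite (paths P) \<and> paths P \<noteq> {}"
proof (induction rule: simple_body.induct)
  case (5 P1 P2)
  have "seq_paths (paths P1) (paths P2)
      \<subseteq> paths P1 \<union> (\<lambda>(p, q). p @ q) ` (paths P1 \<times> paths P2)"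
    by (auto simp: seq_paths_def)
  moreover have "seq_paths (paths P1) (paths P2) \<noteq> {}"
    using 5 by (auto simp: seq_paths_def)
  ultimately show ?case using 5 by (auto intro: finite_subset)
qed auto

section \<open>Tensors\<close>

typedef 'n tensor = "{(s :: 'n \<Rightarrow> nat, f :: ('n \<Rightarrow> nat) \<Rightarrow> real).
    (\<forall>k. 1 \<le> s k) \<and> (\<forall>i. (\<exists>k. s k \<le> i k) \<longrightarrow> f i = 0)}"
  by (rule exI[of _ "(\<lambda>_. 1, \<lambda>_. 0)"]) auto

definition tsize :: "'n tensor \<Rightarrow> 'n \<Rightarrow> nat" where
  "tsize T = fst (Rep_tensor T)"

definition entry :: "'n tensor \<Rightarrow> ('n \<Rightarrow> nat) \<Rightarrow> real" where
  "entry T = snd (Rep_tensor T)"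

(* Only used for sizes s with all s k at least 1. *)
definition tensor :: "('n \<Rightarrow> nat) \<Rightarrow> (('n \<Rightarrow> nat) \<Rightarrow> real) \<Rightarrow> 'n tensor" where
  "tensor s f = Abs_tensor (s, \<lambda>i. if \<forall>k. i k < s k then f i else 0)"

lemma tsize_pos: "1 \<le> tsize T k"
  using Rep_tensor[of T] by (auto simp: tsize_def)

lemma Rep_tensor_tensor:
  "\<forall>k. 1 \<le> s k \<Longrightarrow> Rep_tensor (tensor s f) = (s, \<lambda>i. if \<forall>k. i k < s k then f i else 0)"
  unfolding tensor_def by (subst Abs_tensor_inverse) (auto dest: leD)

lemma tsize_tensor: "\<forall>k. 1 \<le> s k \<Longrightarrow> tsize (tensor s f) = s"
  by (simp add: tsize_def Rep_tensor_tensor)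

lemma entry_tensor: "\<forall>k. 1 \<le> s k \<Longrightarrow> \<forall>k. i k < s k \<Longrightarrow> entry (tensor s f) i = f i"
  by (simp add: entry_def Rep_tensor_tensor)

lemma entry_outside: "tsize T k \<le> i k \<Longrightarrow> entry T i = 0"
  using Rep_tensor[of T] by (auto simp: tsize_def entry_def case_prod_unfold)

lemma tensor_eqI:
  assumes "tsize T = tsize U" "\<And>i. \<forall>k. i k < tsize T k \<Longrightarrow> entry T i = entry U i"
  shows "T = U"
proof -
  have "entry T i = entry U i" for i
  proof (cases "\<forall>k. i k < tsize T k")
    case False
    then obtain k where "tsize T k \<le> i k" by (auto simp: not_less)
    then show ?thesis using assms(1) entry_outside by metis
  qed (use assms(2) in blast)
  then have "Rep_tensor T = Rep_tensor U"
    using assms(1) by (auto simp: prod_eq_iff tsize_def entry_def)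
  then show ?thesis by (simp add: Rep_tensor_inject)
qed

definition smult_tensor :: "real \<Rightarrow> 'n tensor \<Rightarrow> 'n tensor" where
  "smult_tensor c T = tensor (tsize T) (\<lambda>i. c * entry T i)"

section \<open>Eventually geometric distributions\<close>

type_synonym 'n egd = "'n tensor \<times> ('n \<Rightarrow> real)"

definition egds :: "'n egd set" where
  "egds = {(P, \<alpha>). (\<forall>i. 0 \<le> entry P i) \<and> (\<forall>k. 0 \<le> \<alpha> k \<and> \<alpha> k < 1)}"

(* The mass function of EGD(P, alpha).  The exponent max(i - |P| + 1, 0) is written as the
   truncated natural number subtraction i + 1 - |P|, here and below. *)
fun mass :: "'n::finite egd \<Rightarrow> ('n \<Rightarrow> nat) \<Rightarrow> real" where
  "mass (P, \<alpha>) i =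
     entry P (\<lambda>k. min (i k) (tsize P k - 1)) * (\<Prod>k\<in>UNIV. \<alpha> k ^ (i k + 1 - tsize P k))"

definition expand :: "('n \<Rightarrow> nat) \<Rightarrow> 'n::finite egd \<Rightarrow> 'n tensor" where
  "expand s p = tensor s (mass p)"

fun le_egd :: "'n::finite egd \<Rightarrow> 'n egd \<Rightarrow> bool" where
  "le_egd (P, \<alpha>) (Q, \<beta>) \<longleftrightarrow>
     \<alpha> \<le> \<beta> \<and> (\<forall>i. (\<forall>k. i k < max (tsize P k) (tsize Q k)) \<longrightarrow> mass (P, \<alpha>) i \<le> mass (Q, \<beta>) i)"

fun join :: "'n::finite egd \<Rightarrow> 'n egd \<Rightarrow> 'n egd \<Rightarrow> bool" where
  "join (R, \<gamma>) (S, \<delta>) (Q, \<beta>) \<longleftrightarrow>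
     \<gamma> \<le> \<beta> \<and> \<delta> \<le> \<beta> \<and>
     (\<exists>s. tsize R \<le> s \<and> tsize S \<le> s \<and>
          Q = tensor s (\<lambda>i. entry (expand s (R, \<gamma>)) i + entry (expand s (S, \<delta>)) i))"

section \<open>Geometric bound semantics\<close>

(* With i the full index vector, the entry of the slice T_{k:j} at the remaining indices is
   entry T (i(k := j)). *)
primrec geo_event :: "'n event \<Rightarrow> 'n::finite egd \<Rightarrow> 'n egd" where
  "geo_event (VarEq k a) p = (case p of (P, \<alpha>) \<Rightarrow>
     (tensor ((tsize P)(k := max (tsize P k) (a + 2)))
        (\<lambda>i. entry P (i(k := min (i k) (tsize P k - 1))) * \<alpha> k ^ (i k + 1 - tsize P k)
              * of_bool (i k = a)),
      \<alpha>(k := 0)))"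
| "geo_event (Flip \<rho>) p = (case p of (P, \<alpha>) \<Rightarrow> (smult_tensor \<rho> P, \<alpha>))"
| "geo_event (Neg E) p = (case geo_event E p of (R, \<gamma>) \<Rightarrow>
     (tensor (tsize R) (\<lambda>i. mass p i - entry R i), snd p))"
| "geo_event (Conj E1 E2) p = geo_event E2 (geo_event E1 p)"

primrec geo_sem :: "'n prog \<Rightarrow> 'n::finite egd \<Rightarrow> 'n egd \<Rightarrow> bool" where
  "geo_sem Skip p q \<longleftrightarrow> q = p"
| "geo_sem (Seq P1 P2) p q \<longleftrightarrow> (\<exists>r\<in>egds. geo_sem P1 p r \<and> geo_sem P2 r q)"
| "geo_sem (SetZero k) p q \<longleftrightarrow> (case p of (P, \<alpha>) \<Rightarrow>
     q = (tensor ((tsize P)(k := 2))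
            (\<lambda>i. if i k = 0
                  then entry P (i(k := tsize P k - 1)) / (1 - \<alpha> k)
                       + (\<Sum>j<tsize P k - 1. entry P (i(k := j)))
                  else 0),
          \<alpha>(k := 0)))"
| "geo_sem (Inc k a) p q \<longleftrightarrow> (case p of (P, \<alpha>) \<Rightarrow>
     q = (tensor ((tsize P)(k := tsize P k + a))
            (\<lambda>i. if i k < a then 0 else entry P (i(k := i k - a))),
          \<alpha>))"
| "geo_sem (Dec k) p q \<longleftrightarrow> (case p of (P, \<alpha>) \<Rightarrow>
     q = (tensor ((tsize P)(k := max (tsize P k - 1) 2))
            (\<lambda>i. if i k = 0
                  then entry P (i(k := 0))
                       + entry P (i(k := min (tsize P k - 1) 1)) * \<alpha> k ^ (2 - tsize P k)
                  else entry P (i(k := min (tsize P k - 1) (i k + 1)))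
                         * \<alpha> k ^ (i k + 2 - tsize P k)),
          \<alpha>))"
| "geo_sem (Ite E P1 P2) p q \<longleftrightarrow>
     (\<exists>r\<in>egds. \<exists>s\<in>egds. geo_sem P1 (geo_event E p) r \<and> geo_sem P2 (geo_event (Neg E) p) s
                       \<and> join r s q)"
| "geo_sem (While E B) p q \<longleftrightarrow>
     (\<exists>c R \<gamma>. \<exists>s\<in>egds. 0 \<le> c \<and> c < 1 \<and> (R, \<gamma>) \<in> egds \<and>
        le_egd p (R, \<gamma>) \<and>
        geo_sem B (geo_event E (R, \<gamma>)) s \<and>
        le_egd s (smult_tensor c R, \<gamma>) \<and>
        geo_event (Neg E) (smult_tensor (1 / (1 - c)) R, \<gamma>) = q)"
| "geo_sem Fail p q \<longleftrightarrow> q = (tensor (\<lambda>_. 1) (\<lambda>_. 0), \<lambda>_. 0)"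

end

(* A loop body guarded by E never truncates a decrement, so it acts as a random walk with
   displacement xi.  It scales the geometric mass function C * prod_k gamma_k^(x_k) by at most
   c = rho * weight, where rho is the largest probability of E and weight = E[prod_k gamma_k^(-xi_k)].
   For gamma_k = exp(-e l_k) with small e > 0 this factor is below 1: either rho or the probability
   of not failing is below 1, and weight tends to the latter as e tends to 0, or the coefficients
   give a ranking whose drift, the derivative of weight at e = 0, is negative.  A one-entry tensor
   with decay gamma is then a loop invariant up to the factor c.  Keeping gamma as the decay rate at
   every join preserves the geometric upper bound, whatever sizes are chosen. *)

theory Submission
  imports Defs
begin

text \<open>The obstacle is truncation at 0. Where \<open>X_k\<close> is 0 or 1, a decrement merges
  two entries, so a bound \<open>D * geo \<gamma>\<close> would grow by the factor
  \<open>1 + \<gamma> k\<close> instead of shrinking by \<open>\<gamma> k\<close>. Bounds are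
  therefore carried together with a lower bound on the support: the guard supplies it and every
  decrement uses up one unit of it. Two demands are made on \<open>\<gamma>\<close>: it must
  dominate \<open>\<alpha>\<close>, and the loop must contract. Along
  \<open>exp (- (e * l k))\<close> both hold for all small \<open>e > 0\<close>, so one
  \<open>e\<close> meets them together. Decay rates below 1 need positive \<open>l k\<close>,
  whereas the coefficients may vanish, so these are first perturbed. An event takes only finitely
  many probabilities, so their maximum \<open>\<rho>\<close> is attained. If neither
  \<open>\<rho>\<close> nor the survival probability leaves slack, some state makes \<open>E\<close>
  certain. The ranking inequality at that one state suffices, because the drift does not depend on
  the state.\<close>

section \<open>Event probabilities and the geometric event semantics\<close>

text \<open>Events act on mass functions by pointwise multiplication with this factor, in both
  semantics. Conjunction restricts successively, hence the product.\<close>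

primrec ev_prob :: "'n event \<Rightarrow> ('n \<Rightarrow> nat) \<Rightarrow> real" where
  "ev_prob (VarEq k a) x = of_bool (x k = a)"
| "ev_prob (Flip \<rho>) x = \<rho>"
| "ev_prob (Neg E) x = 1 - ev_prob E x"
| "ev_prob (Conj E1 E2) x = ev_prob E1 x * ev_prob E2 x"

lemma ev_prob_bounds:
  assumes "wf_event E"
  shows "0 \<le> ev_prob E x" "ev_prob E x \<le> 1"
  using assms by (induction E) (auto intro: mult_le_one)

text \<open>Makes the supremum of the probabilities of \<open>E\<close> a maximum. A maximum equal
  to 1 then provides a state in which \<open>E\<close> is certain.\<close>

lemma finite_range_ev_prob: "finite (range (ev_prob E))"
proof (induction E)
  case (VarEq k a)
  have "range (ev_prob (VarEq k a)) \<subseteq> {0, 1}" by auto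
  then show ?case by (rule finite_subset) simp
next
  case (Flip \<rho>)
  have "range (ev_prob (Flip \<rho>)) \<subseteq> {\<rho>}" by auto
  then show ?case by (rule finite_subset) simp
next
  case (Neg E)
  have "range (ev_prob (Neg E)) = (\<lambda>p. 1 - p) ` range (ev_prob E)" by auto
  with Neg show ?case by simp
next
  case (Conj E1 E2)
  have "range (ev_prob (Conj E1 E2))
      \<subseteq> (\<lambda>(p, q). p * q) ` (range (ev_prob E1) \<times> range (ev_prob E2))" by auto
  then show ?case by (rule finite_subset) (use Conj in auto)
qed

section \<open>Evaluating mass functions through finite tensors\<close>

abbreviation clamp :: "('n \<Rightarrow> nat) \<Rightarrow> ('n \<Rightarrow> nat) \<Rightarrow> 'n \<Rightarrow> nat" where
  "clamp s i \<equiv> \<lambda>k. min (i k) (s k - 1)"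

lemma mass_inside: "(\<And>k. i k < tsize P k) \<Longrightarrow> mass (P, \<alpha>) i = entry P i"
proof -
  assume i: "\<And>k. i k < tsize P k"
  have 1: "(\<lambda>k. min (i k) (tsize P k - 1)) = i"
  proof
    fix k show "min (i k) (tsize P k - 1) = i k" using i[of k] by linarith
  qed
  have "(\<Prod>k\<in>UNIV. \<alpha> k ^ (i k + 1 - tsize P k)) = 1"
    using i by (intro prod.neutral) (simp add: Suc_le_eq)
  with 1 show ?thesis by simp
qed

lemma clamp_less: "(\<And>k. 1 \<le> s k) \<Longrightarrow> clamp s i k < s k"
proof -
  assume "\<And>k. 1 \<le> s k"
  from this[of k] show ?thesis by linarith
qed

lemma Suc_0_le_tsize [simp]: "Suc 0 \<le> tsize P k"
  using tsize_pos[of P k] by simp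

lemma mass_tensor:
  assumes "\<And>k. 1 \<le> s k"
  shows "mass (tensor s f, \<beta>) i = f (clamp s i) * (\<Prod>k\<in>UNIV. \<beta> k ^ (i k + 1 - s k))"
proof -
  have 1: "tsize (tensor s f) = s" using assms by (simp add: tsize_tensor)
  have "entry (tensor s f) (clamp s i) = f (clamp s i)"
    using assms clamp_less[of s i, OF assms] by (intro entry_tensor allI)
  then show ?thesis by (simp only: mass.simps 1)
qed

text \<open>The exponents of \<open>\<alpha>\<close> split additively at \<open>s\<close>, so the
  mass function is determined by its values in any box that contains the tensor. This is why
  expansions are harmless.\<close>

lemma mass_clamp:
  assumes "tsize P \<le> s"
  shows "mass (P, \<alpha>) i = mass (P, \<alpha>) (clamp s i) * (\<Prod>k\<in>UNIV. \<alpha> k ^ (i k + 1 - s k))"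
proof -
  have s: "1 \<le> tsize P k" "tsize P k \<le> s k" for k
    using assms tsize_pos by (auto simp: le_fun_def)
  have 1: "min (min (i k) (s k - 1)) (tsize P k - 1) = min (i k) (tsize P k - 1)" for k
    using s[of k] by auto
  have "\<alpha> k ^ (i k + 1 - tsize P k)
      = \<alpha> k ^ (min (i k) (s k - 1) + 1 - tsize P k) * \<alpha> k ^ (i k + 1 - s k)" for k
  proof -
    have "i k + 1 - tsize P k = (min (i k) (s k - 1) + 1 - tsize P k) + (i k + 1 - s k)"
      using s[of k] by linarith
    then show ?thesis by (metis power_add)
  qed
  then have "(\<Prod>k\<in>UNIV. \<alpha> k ^ (i k + 1 - tsize P k))
      = (\<Prod>k\<in>UNIV. \<alpha> k ^ (min (i k) (s k - 1) + 1 - tsize P k)) * (\<Prod>k\<in>UNIV. \<alpha> k ^ (i k + 1 - s k))"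
    by (simp add: prod.distrib)
  then show ?thesis by (simp only: mass.simps 1 mult.assoc)
qed

text \<open>Connects the slice formulas of the semantics, which leave the tensor in one coordinate
  only, with the mass function.\<close>

lemma mass_update:
  assumes "\<And>l. l \<noteq> k \<Longrightarrow> i l < tsize P l"
  shows "mass (P, \<alpha>) (i(k := j))
    = entry P (i(k := min j (tsize P k - 1))) * \<alpha> k ^ (j + 1 - tsize P k)"
proof -
  have "min (i l) (tsize P l - 1) = i l" if "l \<noteq> k" for l
    using assms[OF that] by linarith
  then have 1: "(\<lambda>l. min ((i(k := j)) l) (tsize P l - 1)) = i(k := min j (tsize P k - 1))"
    by auto
  have "(\<Prod>l\<in>UNIV. \<alpha> l ^ ((i(k := j)) l + 1 - tsize P l))
      = (\<Prod>l\<in>UNIV. if l = k then \<alpha> k ^ (j + 1 - tsize P k) else 1)"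
    using assms by (intro prod.cong) (auto simp: Suc_le_eq)
  with 1 show ?thesis by simp
qed

lemma mass_nonneg: "p \<in> egds \<Longrightarrow> 0 \<le> mass p i"
  by (cases p) (auto simp: egds_def intro!: mult_nonneg_nonneg prod_nonneg)

lemma egds_tensorI:
  assumes "\<And>k. 1 \<le> s k" "\<And>i. (\<And>k. i k < s k) \<Longrightarrow> 0 \<le> f i" "\<And>k. 0 \<le> \<beta> k \<and> \<beta> k < 1"
  shows "(tensor s f, \<beta>) \<in> egds"
proof -
  have "0 \<le> entry (tensor s f) i" for i
  proof (cases "\<forall>k. i k < s k")
    case True
    with assms show ?thesis by (simp add: entry_tensor)
  next
    case False
    then obtain k where "tsize (tensor s f) k \<le> i k"
      using assms(1) by (auto simp: tsize_tensor not_less)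
    then show ?thesis by (simp add: entry_outside)
  qed
  with assms(3) show ?thesis by (simp add: egds_def)
qed

lemma mass_smult: "mass (smult_tensor c P, \<alpha>) i = c * mass (P, \<alpha>) i"
  by (subst smult_tensor_def, subst mass_tensor) (auto simp: tsize_pos)

lemma smult_egds: "(P, \<alpha>) \<in> egds \<Longrightarrow> 0 \<le> c \<Longrightarrow> (smult_tensor c P, \<alpha>) \<in> egds"
  unfolding smult_tensor_def by (rule egds_tensorI) (auto simp: egds_def tsize_pos)

lemma tsize_smult [simp]: "tsize (smult_tensor c P) = tsize P"
  unfolding smult_tensor_def by (rule tsize_tensor) (simp add: tsize_pos)

text \<open>Negation combines the tensor computed for the negated event with the decay rates of the
  original distribution.  This is exact only because the tensor is large enough to resolve the
  event, which is the last conclusion.\<close>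

lemma geo_event_exact:
  assumes "wf_event E" "p \<in> egds"
  shows "geo_event E p \<in> egds \<and> snd (geo_event E p) \<le> snd p
    \<and> tsize (fst p) \<le> tsize (fst (geo_event E p))
    \<and> (\<forall>i. mass (geo_event E p) i = ev_prob E i * mass p i)
    \<and> (\<forall>i. ev_prob E (clamp (tsize (fst (geo_event E p))) i) = ev_prob E i)"
  using assms
proof (induction E arbitrary: p)
  case (VarEq k a)
  obtain P \<alpha> where p: "p = (P, \<alpha>)" by (cases p)
  have \<alpha>: "0 \<le> \<alpha> l" "\<alpha> l < 1" for l using VarEq.prems p by (auto simp: egds_def)
  \<comment> \<open>Size \<open>a + 2\<close> keeps the index \<open>a + 1\<close> inside the
    tensor, so clamping never moves an index above \<open>a\<close> onto \<open>a\<close>.\<close>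
  define s where "s = (tsize P)(k := max (tsize P k) (a + 2))"
  have s: "1 \<le> s l" "tsize P l \<le> s l" "s k \<ge> a + 2" for l
    using tsize_pos[of P] by (auto simp: s_def)
  define f where "f = (\<lambda>i. entry P (i(k := min (i k) (tsize P k - 1)))
      * \<alpha> k ^ (i k + 1 - tsize P k) * of_bool (i k = a))"
  have eq: "geo_event (VarEq k a) p = (tensor s f, \<alpha>(k := 0))"
    by (simp add: p s_def f_def)
  have f: "f i = mass p i * of_bool (i k = a)" if "\<And>l. i l < s l" for i
  proof -
    have "i l < tsize P l" if "l \<noteq> k" for l
      using \<open>\<And>l. i l < s l\<close>[of l] that by (simp add: s_def)
    from mass_update[of k i P \<alpha> "i k", OF this] show ?thesis by (simp add: f_def p)
  qed
  have nn: "0 \<le> f i" if "\<And>l. i l < s l" for i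
    using f[OF that] mass_nonneg[OF VarEq.prems(2), of i] by simp
  have 1: "(tensor s f, \<alpha>(k := 0)) \<in> egds"
    using s \<alpha> nn by (intro egds_tensorI) auto
  have mass: "mass (tensor s f, \<alpha>(k := 0)) i = of_bool (i k = a) * mass p i" for i
  proof -
    have m: "mass (tensor s f, \<alpha>(k := 0)) i
      = mass p (clamp s i) * of_bool (clamp s i k = a) * (\<Prod>l\<in>UNIV. (\<alpha>(k := 0)) l ^ (i l + 1 - s l))"
      using s clamp_less[of s i] by (subst mass_tensor) (auto simp: f)
    show ?thesis
    proof (cases "i k = a")
      case True
      \<comment> \<open>The new rate 0 does no harm: at \<open>i k = a\<close> its exponent is
        \<open>a + 1 - s k = 0\<close>, and \<open>0 ^ 0 = 1\<close>.\<close>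
      have "(\<Prod>l\<in>UNIV. (\<alpha>(k := 0)) l ^ (i l + 1 - s l)) = (\<Prod>l\<in>UNIV. \<alpha> l ^ (i l + 1 - s l))"
        using s(3) True by (intro prod.cong) auto
      moreover have "clamp s i k = a" using s(3) True by simp
      moreover have "mass p i = mass p (clamp s i) * (\<Prod>k\<in>UNIV. \<alpha> k ^ (i k + 1 - s k))"
        unfolding p by (rule mass_clamp) (use s in \<open>auto simp: le_fun_def\<close>)
      ultimately show ?thesis using m True by simp
    next
      case False
      then have "clamp s i k \<noteq> a" using s(3) by (auto simp: min_def)
      with m False show ?thesis by simp
    qed
  qed
  have "(clamp s i k = a) = (i k = a)" for i using s(3) by (auto simp: min_def)
  with 1 mass s \<alpha> show ?case
    unfolding eq by (simp add: tsize_tensor p le_fun_def del: mass.simps)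
next
  case (Flip \<rho>)
  obtain P \<alpha> where p: "p = (P, \<alpha>)" by (cases p)
  show ?case
    using Flip smult_egds[of P \<alpha> \<rho>] by (simp add: p mass_smult del: mass.simps)
next
  case (Neg E)
  obtain P \<alpha> where p: "p = (P, \<alpha>)" by (cases p)
  obtain R \<gamma> where q: "geo_event E p = (R, \<gamma>)" by (cases "geo_event E p")
  have wf: "wf_event E" using Neg.prems by simp
  have IH: "tsize (fst p) \<le> tsize R" "\<And>i. mass (R, \<gamma>) i = ev_prob E i * mass p i"
    "\<And>i. ev_prob E (clamp (tsize R) i) = ev_prob E i"
    using Neg.IH[OF wf Neg.prems(2)] by (simp_all add: q del: mass.simps)
  let ?f = "\<lambda>i. mass p i - entry R i"
  have f: "?f i = (1 - ev_prob E i) * mass p i" if "\<And>k. i k < tsize R k" for i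
    using mass_inside[of i R \<gamma>, OF that] IH(2)[of i] by (simp add: left_diff_distrib)
  have eq: "geo_event (Neg E) p = (tensor (tsize R) ?f, \<alpha>)"
    unfolding geo_event.simps q by (simp add: p)
  have 1: "(tensor (tsize R) ?f, \<alpha>) \<in> egds"
  proof (rule egds_tensorI)
    show "0 \<le> ?f i" if "\<And>k. i k < tsize R k" for i
      unfolding f[OF that] using ev_prob_bounds[OF wf] mass_nonneg[OF Neg.prems(2)] by simp
  qed (use Neg.prems p in \<open>auto simp: egds_def tsize_pos\<close>)
  have 2: "mass (tensor (tsize R) ?f, \<alpha>) i = (1 - ev_prob E i) * mass p i" for i
  proof -
    have "mass (tensor (tsize R) ?f, \<alpha>) i
      = ?f (clamp (tsize R) i) * (\<Prod>k\<in>UNIV. \<alpha> k ^ (i k + 1 - tsize R k))"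
      by (rule mass_tensor) (rule tsize_pos)
    also have "?f (clamp (tsize R) i) = (1 - ev_prob E i) * mass p (clamp (tsize R) i)"
      using f[of "clamp (tsize R) i"] clamp_less[of "tsize R" i, OF tsize_pos] by (simp only: IH(3))
    finally show ?thesis using mass_clamp[of P "tsize R" \<alpha> i] IH(1)
      by (simp add: p del: mass.simps)
  qed
  show ?case
    unfolding eq using 1 2 IH by (simp add: tsize_tensor tsize_pos p del: mass.simps)
next
  case (Conj E1 E2)
  let ?q = "geo_event E1 p"
  have wf: "wf_event E1" "wf_event E2" using Conj.prems by auto
  have IH1: "?q \<in> egds" "snd ?q \<le> snd p" "tsize (fst p) \<le> tsize (fst ?q)"
    "\<And>i. mass ?q i = ev_prob E1 i * mass p i"
    "\<And>i. ev_prob E1 (clamp (tsize (fst ?q)) i) = ev_prob E1 i"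
    using Conj.IH(1)[OF wf(1) Conj.prems(2)] by auto
  let ?r = "geo_event E2 ?q"
  have IH2: "?r \<in> egds" "snd ?r \<le> snd ?q" "tsize (fst ?q) \<le> tsize (fst ?r)"
    "\<And>i. mass ?r i = ev_prob E2 i * mass ?q i"
    "\<And>i. ev_prob E2 (clamp (tsize (fst ?r)) i) = ev_prob E2 i"
    using Conj.IH(2)[OF wf(2) IH1(1)] by auto
  \<comment> \<open>Clamping to the larger size is absorbed by clamping to the smaller one, so the
    tensor for the conjunction still resolves \<open>E1\<close>.\<close>
  have "clamp (tsize (fst ?q)) (clamp (tsize (fst ?r)) i) = clamp (tsize (fst ?q)) i" for i
  proof
    fix k
    have "tsize (fst ?q) k \<le> tsize (fst ?r) k" using IH2(3) by (simp add: le_fun_def)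
    then show "clamp (tsize (fst ?q)) (clamp (tsize (fst ?r)) i) k = clamp (tsize (fst ?q)) i k"
      by simp
  qed
  then have "ev_prob E1 (clamp (tsize (fst ?r)) i) = ev_prob E1 i" for i
    using IH1(5)[of i] IH1(5)[of "clamp (tsize (fst ?r)) i"] by simp
  then show ?case
    using IH1 IH2 by (auto simp: order.trans)
qed

section \<open>Geometric bounds for simple loop bodies\<close>

abbreviation geo :: "('n::finite \<Rightarrow> real) \<Rightarrow> ('n \<Rightarrow> nat) \<Rightarrow> real" where
  "geo \<gamma> i \<equiv> \<Prod>k\<in>UNIV. \<gamma> k ^ i k"

text \<open>\<open>snd p \<le> \<gamma>\<close> lets joins use the rate \<open>\<gamma>\<close> and
  is half of the final comparison by \<open>le_egd\<close>. The bound \<open>r\<close> guarantees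
  that \<open>r k\<close> decrements of \<open>X_k\<close> are not truncated.\<close>

definition geo_bounded :: "('n::finite \<Rightarrow> real) \<Rightarrow> ('n \<Rightarrow> nat) \<Rightarrow> real \<Rightarrow> 'n egd \<Rightarrow> bool" where
  "geo_bounded \<gamma> r D p \<longleftrightarrow> p \<in> egds \<and> snd p \<le> \<gamma> \<and>
     (\<forall>i. mass p i \<le> D * geo \<gamma> i) \<and> (\<forall>i. mass p i \<noteq> 0 \<longrightarrow> r \<le> i)"

lemma geo_clamp:
  assumes "\<And>k. 1 \<le> s k"
  shows "geo \<gamma> i = geo \<gamma> (clamp s i) * (\<Prod>k\<in>UNIV. \<gamma> k ^ (i k + 1 - s k))"
proof -
  have "\<gamma> k ^ i k = \<gamma> k ^ clamp s i k * \<gamma> k ^ (i k + 1 - s k)" for k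
  proof -
    have "i k = clamp s i k + (i k + 1 - s k)" using assms[of k] by linarith
    then show ?thesis by (metis power_add)
  qed
  then show ?thesis by (simp add: prod.distrib)
qed

lemma geo_update: "geo \<gamma> (i(k := j)) = \<gamma> k ^ j * (\<Prod>l\<in>UNIV - {k}. \<gamma> l ^ i l)"
  by (subst prod.remove[of _ k]) auto

text \<open>Beyond the box the mass decays at rate \<open>\<beta>\<close> and the bound only at rate
  \<open>\<gamma> \<ge> \<beta>\<close>, so checking the box suffices. The support condition
  transfers because clamping only lowers indices.\<close>

lemma geo_bounded_tensorI:
  assumes s: "\<And>k. 1 \<le> s k" and \<beta>: "\<And>k. 0 \<le> \<beta> k \<and> \<beta> k < 1" and le: "\<beta> \<le> \<gamma>"
    and nonneg: "\<And>i. (\<And>k. i k < s k) \<Longrightarrow> 0 \<le> f i"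
    and bound: "\<And>i. (\<And>k. i k < s k) \<Longrightarrow> f i \<le> D * geo \<gamma> i"
    and supp: "\<And>i. (\<And>k. i k < s k) \<Longrightarrow> f i \<noteq> 0 \<Longrightarrow> r \<le> i"
  shows "geo_bounded \<gamma> r D (tensor s f, \<beta>)"
proof -
  have c: "clamp s i k < s k" for i k using s by (rule clamp_less)
  have m: "mass (tensor s f, \<beta>) i = f (clamp s i) * (\<Prod>k\<in>UNIV. \<beta> k ^ (i k + 1 - s k))" for i
    using s by (rule mass_tensor)
  have "mass (tensor s f, \<beta>) i \<le> D * geo \<gamma> i" for i
  proof -
    have "(\<Prod>k\<in>UNIV. \<beta> k ^ (i k + 1 - s k)) \<le> (\<Prod>k\<in>UNIV. \<gamma> k ^ (i k + 1 - s k))"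
      using \<beta> le by (intro prod_mono) (auto simp: le_fun_def intro: power_mono)
    then have "mass (tensor s f, \<beta>) i \<le> f (clamp s i) * (\<Prod>k\<in>UNIV. \<gamma> k ^ (i k + 1 - s k))"
      unfolding m by (rule mult_left_mono) (rule nonneg[OF c])
    also have "\<dots> \<le> (D * geo \<gamma> (clamp s i)) * (\<Prod>k\<in>UNIV. \<gamma> k ^ (i k + 1 - s k))"
      using \<beta> le by (intro mult_right_mono bound c prod_nonneg)
        (auto simp: le_fun_def intro: zero_le_power order.trans)
    also have "\<dots> = D * geo \<gamma> i" using geo_clamp[of s \<gamma> i] s by simp
    finally show ?thesis .
  qed
  moreover have "r \<le> i" if "mass (tensor s f, \<beta>) i \<noteq> 0" for i
  proof -
    from that have "f (clamp s i) \<noteq> 0" unfolding m by auto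
    then have "r \<le> clamp s i" using c by (intro supp)
    then show ?thesis by (auto simp: le_fun_def)
  qed
  ultimately show ?thesis
    unfolding geo_bounded_def using egds_tensorI[of s f \<beta>] s \<beta> nonneg le by (simp del: mass.simps)
qed

lemma geo_bounded_event:
  assumes "wf_event E" "geo_bounded \<gamma> r D p" "\<And>i. ev_prob E i \<le> \<rho>"
  shows "geo_bounded \<gamma> r (\<rho> * D) (geo_event E p)"
proof -
  have p: "p \<in> egds" and le: "snd p \<le> \<gamma>" and bd: "\<And>i. mass p i \<le> D * geo \<gamma> i"
    and supp: "\<And>i. mass p i \<noteq> 0 \<Longrightarrow> r \<le> i"
    using assms(2) by (auto simp: geo_bounded_def)
  note ex = geo_event_exact[OF assms(1) p]
  have "mass (geo_event E p) i \<le> \<rho> * D * geo \<gamma> i" for i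
  proof -
    have "ev_prob E i * mass p i \<le> \<rho> * mass p i"
      by (intro mult_right_mono assms(3) mass_nonneg p)
    also have "\<dots> \<le> \<rho> * (D * geo \<gamma> i)"
      using assms(3) ev_prob_bounds(1)[OF assms(1)] by (intro mult_left_mono bd) (rule order.trans)
    finally show ?thesis using ex by simp
  qed
  then show ?thesis using ex le supp by (auto simp: geo_bounded_def intro: order.trans)
qed

text \<open>The weight of a body is \<open>\<Sum>\<xi>. q \<xi> * \<gamma> powi (- \<xi>)\<close>, where \<open>q \<xi>\<close> is the probability that
  the body terminates after displacing the state by \<open>\<xi>\<close> without truncating a decrement.
  Commands that do not occur in simple bodies get arbitrary values here and below.\<close>

primrec weight :: "('n \<Rightarrow> real) \<Rightarrow> 'n prog \<Rightarrow> real" where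
  "weight \<gamma> Skip = 1"
| "weight \<gamma> (Seq P1 P2) = weight \<gamma> P1 * weight \<gamma> P2"
| "weight \<gamma> (SetZero k) = 0"
| "weight \<gamma> (Inc k a) = (1 / \<gamma> k) ^ a"
| "weight \<gamma> (Dec k) = \<gamma> k"
| "weight \<gamma> (Ite E P1 P2)
     = (case E of Flip \<rho> \<Rightarrow> \<rho> * weight \<gamma> P1 + (1 - \<rho>) * weight \<gamma> P2 | _ \<Rightarrow> 0)"
| "weight \<gamma> (While E P) = 0"
| "weight \<gamma> Fail = 0"

lemma weight_nonneg:
  assumes "simple_body B" "wf_prog B" "\<And>k. 0 \<le> \<gamma> k"
  shows "0 \<le> weight \<gamma> B"
  using assms by (induction rule: simple_body.induct) auto

text \<open>The vector \<open>r\<close> bounds the state from below before \<open>B\<close> and \<open>r'\<close> bounds it after \<open>B\<close>.  Only the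
  paths without failure constrain \<open>r'\<close>, since failing paths contribute the zero tensor.\<close>

lemma geo_sem_simple_body:
  assumes "simple_body B" "wf_prog B"
    and "\<And>k. 0 < \<gamma> k \<and> \<gamma> k < 1"
    and "geo_bounded \<gamma> r D p"
    and "\<And>\<pi> k. \<pi> \<in> paths B \<Longrightarrow> count_list \<pi> (Dec k) \<le> r k"
    and "\<And>\<pi> k. \<pi> \<in> paths B \<Longrightarrow> Fail \<notin> set \<pi> \<Longrightarrow> r' k + count_list \<pi> (Dec k) \<le> r k"
  shows "\<exists>q. geo_sem B p q \<and> geo_bounded \<gamma> r' (D * weight \<gamma> B) q"
  using assms
proof (induction arbitrary: r r' D p rule: simple_body.induct)
  case (1 k)
  obtain P \<alpha> where p: "p = (P, \<alpha>)" by (cases p)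
  have \<alpha>: "0 \<le> \<alpha> l" "\<alpha> l < 1" and le: "\<alpha> \<le> \<gamma>" and pe: "p \<in> egds"
    and bd: "\<And>i. mass p i \<le> D * geo \<gamma> i" and supp: "\<And>i. mass p i \<noteq> 0 \<Longrightarrow> r \<le> i" for l
    using 1 by (auto simp: geo_bounded_def egds_def p)
  define s where "s = (tsize P)(k := tsize P k + 1)"
  define f where "f = (\<lambda>i. if i k < 1 then 0 else entry P (i(k := i k - 1)))"
  have r': "r' \<le> r" using 1(4)[of "[Inc k 1]"] 1(5)[of "[Inc k 1]"] by (auto simp: le_fun_def)
  have f: "f i = (if i k < 1 then 0 else mass p (i(k := i k - 1)))" if "\<And>l. i l < s l" for i
  proof (cases "i k < 1")
    case False
    have "(i(k := i k - 1)) l < tsize P l" for l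
      using that[of l] False by (cases "l = k") (auto simp: s_def)
    then have "mass p (i(k := i k - 1)) = entry P (i(k := i k - 1))"
      unfolding p by (rule mass_inside)
    with False show ?thesis by (simp add: f_def)
  qed (simp add: f_def)
  have "geo_bounded \<gamma> r' (D * weight \<gamma> (Inc k 1)) (tensor s f, \<alpha>)"
  proof (rule geo_bounded_tensorI)
    fix i assume i: "\<And>l. i l < s l"
    show "0 \<le> f i" using f[OF i] mass_nonneg[OF pe] by (simp del: mass.simps)
    show "f i \<le> D * weight \<gamma> (Inc k 1) * geo \<gamma> i"
    proof (cases "i k < 1")
      case True
      \<comment> \<open>No sign of \<open>D\<close> is assumed; the nonnegative mass below the bound
        provides it.\<close>
      have "0 \<le> D * geo \<gamma> i" using bd[of i] mass_nonneg[OF pe, of i] by linarith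
      then have "0 \<le> D * geo \<gamma> i / \<gamma> k" using 1(2) by (intro divide_nonneg_nonneg) (auto intro: less_imp_le)
      with True show ?thesis using f[OF i] by simp
    next
      case False
      have "geo \<gamma> i = geo \<gamma> (i(k := Suc (i k - 1)))" using False by simp
      then have "geo \<gamma> i = \<gamma> k * geo \<gamma> (i(k := i k - 1))" unfolding geo_update by simp
      then have "geo \<gamma> (i(k := i k - 1)) = geo \<gamma> i / \<gamma> k" using 1(2)[of k] by simp
      with bd[of "i(k := i k - 1)"] False show ?thesis using f[OF i] by simp
    qed
    show "r' \<le> i" if "f i \<noteq> 0"
    proof -
      from that f[OF i] have "r \<le> i(k := i k - 1)"
        by (intro supp) (auto simp del: mass.simps split: if_splits)
      then have "r l \<le> i l" for l by (cases "l = k") (auto simp: le_fun_def dest!: spec[of _ l])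
      with r' show ?thesis by (auto simp: le_fun_def intro: order.trans)
    qed
  qed (use \<alpha> le in \<open>auto simp: s_def\<close>)
  then show ?case by (intro exI[of _ "(tensor s f, \<alpha>)"]) (simp only: geo_sem.simps p prod.case s_def f_def simp_thms)
next
  case (2 k)
  obtain P \<alpha> where p: "p = (P, \<alpha>)" by (cases p)
  have \<alpha>: "0 \<le> \<alpha> l" "\<alpha> l < 1" and le: "\<alpha> \<le> \<gamma>" and pe: "p \<in> egds"
    and bd: "\<And>i. mass p i \<le> D * geo \<gamma> i" and supp: "\<And>i. mass p i \<noteq> 0 \<Longrightarrow> r \<le> i" for l
    using 2 by (auto simp: geo_bounded_def egds_def p)
  define s where "s = (tsize P)(k := max (tsize P k - 1) 2)"
  define f where "f = (\<lambda>i. if i k = 0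
                  then entry P (i(k := 0))
                       + entry P (i(k := min (tsize P k - 1) 1)) * \<alpha> k ^ (2 - tsize P k)
                  else entry P (i(k := min (tsize P k - 1) (i k + 1)))
                         * \<alpha> k ^ (i k + 2 - tsize P k))"
  have rk: "r' k + 1 \<le> r k" and r': "r' l \<le> r l" for l
    using 2(5)[of "[Dec k]" k] 2(5)[of "[Dec k]" l] by (auto split: if_splits)
  have f: "f i = mass p (i(k := i k + 1))" if i: "\<And>l. i l < s l" for i
  proof -
    have il: "i l < tsize P l" if "l \<noteq> k" for l using i[of l] that by (simp add: s_def)
    have m: "mass p (i(k := j))
      = entry P (i(k := min j (tsize P k - 1))) * \<alpha> k ^ (j + 1 - tsize P k)" for j
      unfolding p using il by (rule mass_update)
    show ?thesis
    proof (cases "i k = 0")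
      case True
      \<comment> \<open>Here truncation is excluded: \<open>r k \<ge> 1\<close> forces the slice at
        0 to vanish, so the merged entry reduces to the one shifted down from index 1.\<close>
      have "\<not> r \<le> i(k := 0)" using rk by (auto simp: le_fun_def dest!: spec[of _ k])
      then have "mass p (i(k := 0)) = 0" using supp by blast
      then have "entry P (i(k := 0)) = 0" using m[of 0] tsize_pos[of P k] by simp
      then show ?thesis using True m[of 1] by (simp add: f_def min.commute numeral_2_eq_2)
    next
      case False
      then show ?thesis using m[of "i k + 1"] by (simp add: f_def min.commute)
    qed
  qed
  have "geo_bounded \<gamma> r' (D * weight \<gamma> (Dec k)) (tensor s f, \<alpha>)"
  proof (rule geo_bounded_tensorI)
    fix i assume i: "\<And>l. i l < s l"
    show "0 \<le> f i" using f[OF i] mass_nonneg[OF pe] by (simp del: mass.simps)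
    have "geo \<gamma> (i(k := i k + 1)) = \<gamma> k * geo \<gamma> (i(k := i k))"
      unfolding geo_update by simp
    then show "f i \<le> D * weight \<gamma> (Dec k) * geo \<gamma> i"
      using bd[of "i(k := i k + 1)"] f[OF i] by (simp add: mult.assoc del: mass.simps)
    show "r' \<le> i" if "f i \<noteq> 0"
    proof (rule le_funI)
      fix l
      from that f[OF i] have "r \<le> i(k := i k + 1)"
        by (intro supp) (auto simp del: mass.simps)
      then have "r l \<le> (i(k := i k + 1)) l" by (rule le_funD)
      with r'[of l] rk show "r' l \<le> i l" by (cases "l = k") auto
    qed
  qed (use \<alpha> le in \<open>auto simp: s_def\<close>)
  then show ?case by (auto simp: p s_def f_def)
next
  case 3
  have "geo_bounded \<gamma> r' (D * weight \<gamma> Fail) (tensor (\<lambda>_. 1) (\<lambda>_. 0), \<lambda>_. 0)"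
    using 3(2) by (intro geo_bounded_tensorI) (auto simp: le_fun_def less_imp_le)
  then show ?case by auto
next
  case (4 P1 P2 \<rho>)
  have \<rho>: "wf_event (Flip \<rho> :: 'n event)" "wf_event (Neg (Flip \<rho>) :: 'n event)"
    and wf: "wf_prog P1" "wf_prog P2"
    using 4(5) by auto
  have b1: "geo_bounded \<gamma> r (\<rho> * D) (geo_event (Flip \<rho>) p)"
    using geo_bounded_event[OF \<rho>(1) 4(7)] by simp
  have b2: "geo_bounded \<gamma> r ((1 - \<rho>) * D) (geo_event (Neg (Flip \<rho>)) p)"
    by (rule geo_bounded_event[OF \<rho>(2) 4(7)]) simp
  obtain q1 where q1: "geo_sem P1 (geo_event (Flip \<rho>) p) q1"
    "geo_bounded \<gamma> r' (\<rho> * D * weight \<gamma> P1) q1"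
    using 4(3)[OF wf(1) 4(6) b1, of r'] 4(8,9) by auto
  obtain q2 where q2: "geo_sem P2 (geo_event (Neg (Flip \<rho>)) p) q2"
    "geo_bounded \<gamma> r' ((1 - \<rho>) * D * weight \<gamma> P2) q2"
    using 4(4)[OF wf(2) 4(6) b2, of r'] 4(8,9) by auto
  obtain R \<alpha> S \<beta> where q: "q1 = (R, \<alpha>)" "q2 = (S, \<beta>)" by (cases q1, cases q2)
  define s where "s = (\<lambda>k. max (tsize R k) (tsize S k))"
  define f where "f = (\<lambda>i. entry (expand s q1) i + entry (expand s q2) i)"
  have s: "1 \<le> s k" for k by (simp add: s_def le_max_iff_disj)
  have f: "f i = mass q1 i + mass q2 i" if "\<And>k. i k < s k" for i
    using s that by (simp add: f_def expand_def entry_tensor del: mass.simps)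
  have "geo_bounded \<gamma> r' (D * weight \<gamma> (Ite (Flip \<rho>) P1 P2)) (tensor s f, \<gamma>)"
  proof (rule geo_bounded_tensorI)
    fix i assume i: "\<And>k. i k < s k"
    show "0 \<le> f i" using f[OF i] q1(2) q2(2) by (simp add: geo_bounded_def mass_nonneg)
    have "f i \<le> \<rho> * D * weight \<gamma> P1 * geo \<gamma> i + (1 - \<rho>) * D * weight \<gamma> P2 * geo \<gamma> i"
      unfolding f[OF i] using q1(2) q2(2) by (intro add_mono) (auto simp: geo_bounded_def)
    then show "f i \<le> D * weight \<gamma> (Ite (Flip \<rho>) P1 P2) * geo \<gamma> i"
      by (simp add: algebra_simps)
    show "r' \<le> i" if "f i \<noteq> 0"
    proof -
      from that f[OF i] have "mass q1 i \<noteq> 0 \<or> mass q2 i \<noteq> 0" by auto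
      with q1(2) q2(2) show ?thesis by (auto simp: geo_bounded_def simp del: mass.simps)
    qed
  next
    show "1 \<le> s k" for k by (rule s)
  qed (use 4(6) in \<open>auto intro: less_imp_le\<close>)
  moreover have "join q1 q2 (tensor s f, \<gamma>)"
    using q1(2) q2(2) by (auto simp: q geo_bounded_def f_def le_fun_def s_def intro!: exI[of _ s])
  moreover have "q1 \<in> egds" "q2 \<in> egds" using q1(2) q2(2) by (auto simp: geo_bounded_def)
  ultimately show ?case using q1(1) q2(1) by (simp del: geo_event.simps) blast
next
  case (5 P1 P2)
  have wf: "wf_prog P1" "wf_prog P2" using 5(5) by auto
  note fin = finite_paths_simple_body[OF 5(2)]
  \<comment> \<open>The maximum \<open>r1\<close> is the least lower bound on the state between
    \<open>P1\<close> and \<open>P2\<close> that meets both path conditions of \<open>P2\<close>.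
    Failing paths contribute the decrements executed before the failure.\<close>
  define M where "M k = (\<lambda>\<pi>. count_list \<pi> (Dec k)) ` paths P2
      \<union> (\<lambda>\<pi>. r' k + count_list \<pi> (Dec k)) ` {\<pi> \<in> paths P2. Fail \<notin> set \<pi>}" for k
  define r1 where "r1 k = Max (M k)" for k
  have M: "finite (M k)" "M k \<noteq> {}" for k using fin by (auto simp: M_def)
  have le1: "count_list \<pi> (Dec k) \<le> r k" if "\<pi> \<in> paths P1" for \<pi> k
  proof (cases "Fail \<in> set \<pi>")
    case True
    then show ?thesis using that by (intro 5(8)) (auto simp: seq_paths_def)
  next
    case False
    obtain \<pi>2 where "\<pi>2 \<in> paths P2" using fin by auto
    with False that have "\<pi> @ \<pi>2 \<in> paths (Seq P1 P2)" by (auto simp: seq_paths_def)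
    from 5(8)[OF this, of k] show ?thesis by simp
  qed
  have le2: "r1 k + count_list \<pi> (Dec k) \<le> r k" if \<pi>: "\<pi> \<in> paths P1" "Fail \<notin> set \<pi>" for \<pi> k
  proof -
    have "x + count_list \<pi> (Dec k) \<le> r k" if "x \<in> M k" for x
    proof -
      from that consider \<pi>2 where "\<pi>2 \<in> paths P2" "x = count_list \<pi>2 (Dec k)"
        | \<pi>2 where "\<pi>2 \<in> paths P2" "Fail \<notin> set \<pi>2" "x = r' k + count_list \<pi>2 (Dec k)"
        by (auto simp: M_def)
      then show ?thesis
      proof cases
        case 1
        then have "\<pi> @ \<pi>2 \<in> paths (Seq P1 P2)" using \<pi> by (auto simp: seq_paths_def)
        from 5(8)[OF this, of k] 1 show ?thesis by simp
      next
        case 2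
        then have "\<pi> @ \<pi>2 \<in> paths (Seq P1 P2)" using \<pi> by (auto simp: seq_paths_def)
        from 5(9)[OF this, of k] \<pi> 2 show ?thesis by simp
      qed
    qed
    from this[OF Max_in[OF M]] show ?thesis by (simp add: r1_def)
  qed
  obtain q1 where q1: "geo_sem P1 p q1" "geo_bounded \<gamma> r1 (D * weight \<gamma> P1) q1"
    using 5(3)[OF wf(1) 5(6,7) le1 le2] by blast
  have "count_list \<pi> (Dec k) \<le> r1 k" if "\<pi> \<in> paths P2" for \<pi> k
    unfolding r1_def by (rule Max_ge[OF M(1)]) (use that in \<open>auto simp: M_def\<close>)
  moreover have "r' k + count_list \<pi> (Dec k) \<le> r1 k" if "\<pi> \<in> paths P2" "Fail \<notin> set \<pi>" for \<pi> k
    unfolding r1_def by (rule Max_ge[OF M(1)]) (use that in \<open>auto simp: M_def\<close>)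
  ultimately obtain q2 where q2: "geo_sem P2 q1 q2"
    "geo_bounded \<gamma> r' (D * weight \<gamma> P1 * weight \<gamma> P2) q2"
    using 5(4)[OF wf(2) 5(6) q1(2)] by blast
  have "q1 \<in> egds" using q1(2) by (simp add: geo_bounded_def)
  with q1(1) q2(1) have "geo_sem (Seq P1 P2) p q2" by auto
  moreover from q2(2) have "geo_bounded \<gamma> r' (D * weight \<gamma> (Seq P1 P2)) q2"
    by (simp add: mult.assoc)
  ultimately show ?case by blast
qed

section \<open>Drift of a simple loop body\<close>

abbreviation survival :: "'n prog \<Rightarrow> real" where
  "survival \<equiv> weight (\<lambda>_. 1)"

text \<open>The expected change of the linear function with coefficients \<open>l\<close>, summed
  over nonfailing runs and computed as if no decrement were truncated. The clause for
  \<open>Seq\<close> is a product rule.\<close>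

primrec drift :: "('n \<Rightarrow> real) \<Rightarrow> 'n prog \<Rightarrow> real" where
  "drift l Skip = 0"
| "drift l (Seq P1 P2) = drift l P1 * survival P2 + survival P1 * drift l P2"
| "drift l (SetZero k) = 0"
| "drift l (Inc k a) = a * l k"
| "drift l (Dec k) = - l k"
| "drift l (Ite E P1 P2)
     = (case E of Flip \<rho> \<Rightarrow> \<rho> * drift l P1 + (1 - \<rho>) * drift l P2 | _ \<Rightarrow> 0)"
| "drift l (While E P) = 0"
| "drift l Fail = 0"

lemma survival_bounds:
  assumes "simple_body B" "wf_prog B"
  shows "0 \<le> survival B" "survival B \<le> 1"
proof -
  show "0 \<le> survival B" using assms by (rule weight_nonneg) simp
  show "survival B \<le> 1"
    using assms
  proof (induction rule: simple_body.induct)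
    case (4 P1 P2 \<rho>)
    then have "\<rho> * survival P1 + (1 - \<rho>) * survival P2 \<le> 1"
      by (intro convex_bound_le) auto
    then show ?case by simp
  next
    case (5 P1 P2)
    then show ?case by (auto intro!: mult_le_one weight_nonneg)
  qed auto
qed

lemma drift_add_smult:
  "simple_body B \<Longrightarrow> drift (\<lambda>k. l k + c * l' k) B = drift l B + c * drift l' B"
  by (induction rule: simple_body.induct) (auto simp: algebra_simps)

lemma weight_has_derivative:
  assumes "simple_body B"
  shows "((\<lambda>e. weight (\<lambda>k. exp (- (e * l k))) B) has_real_derivative drift l B) (at 0)"
  using assms
proof (induction rule: simple_body.induct)
  case (1 k)
  have "((\<lambda>e. 1 / exp (- (e * l k))) has_real_derivative l k) (at 0)"
    by (auto intro!: derivative_eq_intros)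
  then show ?case by simp
next
  case (2 k)
  show ?case by (auto intro!: derivative_eq_intros)
next
  case (4 P1 P2 \<rho>)
  then show ?case by (auto intro!: derivative_eq_intros)
next
  case (5 P1 P2)
  from DERIV_mult[OF 5(3,4)] show ?case by (simp add: algebra_simps)
qed auto

text \<open>With slack at \<open>e = 0\<close>, continuity suffices and any positive direction will
  do. Otherwise the weight starts at 1 and must decrease; since the drift is linear in
  \<open>l\<close>, a small multiple of the all-ones vector makes \<open>l\<close> positive and
  keeps the drift negative.\<close>

lemma eventually_weight_less_1:
  assumes B: "simple_body B" and l: "\<And>k. 0 \<le> l k" and \<rho>: "\<rho> \<le> 1"
    and drift: "\<rho> * survival B < 1 \<or> (survival B = 1 \<and> drift l B < 0)"
    and "0 \<le> \<rho>"
  obtains l' where "\<And>k. 0 < l' k"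
    "eventually (\<lambda>e. \<rho> * weight (\<lambda>k. exp (- (e * l' k))) B < 1) (at_right 0)"
proof (cases "\<rho> * survival B < 1")
  case True
  let ?w = "\<lambda>e. weight (\<lambda>k. exp (- (e * 1))) B"
  have "isCont ?w 0"
    using DERIV_isCont[OF weight_has_derivative[OF B, of "\<lambda>_. 1"]] by simp
  then have "(?w \<longlongrightarrow> survival B) (at 0)" by (simp add: isCont_def)
  then have "((\<lambda>e. \<rho> * ?w e) \<longlongrightarrow> \<rho> * survival B) (at_right 0)"
    by (intro tendsto_mult_left) (rule tendsto_mono[OF at_le], auto)
  then have "eventually (\<lambda>e. \<rho> * ?w e < 1) (at_right 0)"
    using True by (rule order_tendstoD)
  then show ?thesis by (intro that[of "\<lambda>_. 1"]) auto
next
  case False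
  with drift have s: "survival B = 1" and neg: "drift l B < 0" by auto
  \<comment> \<open>Chosen so that \<open>c\<close> times the absolute drift of the all-ones vector
    stays below \<open>- drift l B\<close>. The summand 1 avoids division by zero and makes this
    strict.\<close>
  define c where "c = - drift l B / (1 + \<bar>drift (\<lambda>_. 1) B\<bar>)"
  have c: "0 < c" using neg unfolding c_def by (intro divide_pos_pos) auto
  define l' where "l' = (\<lambda>k. l k + c * 1)"
  have "c * drift (\<lambda>_. 1) B \<le> c * \<bar>drift (\<lambda>_. 1) B\<bar>" using c by simp
  also have "\<dots> < c * (1 + \<bar>drift (\<lambda>_. 1) B\<bar>)" using c by simp
  also have "\<dots> = - drift l B" by (simp add: c_def)
  finally have "drift l' B < 0"
    unfolding l'_def using drift_add_smult[OF B, of l c "\<lambda>_. 1"] by simp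
  then obtain d where d: "0 < d"
    "\<And>h. 0 < h \<Longrightarrow> h < d \<Longrightarrow> weight (\<lambda>k. exp (- (h * l' k))) B < 1"
    using DERIV_neg_dec_right[OF weight_has_derivative[OF B, of l']] s by auto
  have "eventually (\<lambda>e. \<rho> * weight (\<lambda>k. exp (- (e * l' k))) B < 1) (at_right 0)"
    unfolding eventually_at_right_field
  proof (intro exI[of _ d] conjI allI impI)
    fix e :: real assume e: "0 < e" "e < d"
    let ?w = "weight (\<lambda>k. exp (- (e * l' k))) B"
    show "\<rho> * ?w < 1"
    \<comment> \<open>The sign of \<open>?w\<close> is unknown here, because the probabilities in
      \<open>B\<close> are not assumed to lie between 0 and 1.\<close>
    proof (cases "0 \<le> ?w")
      case True
      then have "\<rho> * ?w \<le> 1 * ?w" using \<rho> by (intro mult_right_mono)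
      with d(2)[OF e] show ?thesis by simp
    next
      case False
      then have "\<rho> * ?w \<le> 0" using \<open>0 \<le> \<rho>\<close> by (intro mult_nonneg_nonpos) auto
      then show ?thesis by simp
    qed
  qed (rule d(1))
  moreover have "0 < l' k" for k using l[of k] c by (simp add: l'_def)
  ultimately show ?thesis by (intro that[of l'])
qed

section \<open>Expectations under the standard semantics\<close>

lemma disc_measure_eq_density:
  fixes M :: "'a::countable measure"
  assumes "disc_measure M"
  shows "M = density (count_space UNIV) (\<lambda>x. emeasure M {x})"
proof (rule measure_eqI_countable[where A = UNIV])
  fix a
  show "emeasure M {a} = emeasure (density (count_space UNIV) (\<lambda>x. emeasure M {x})) {a}"
    by (subst emeasure_density) (auto simp: nn_integral_count_space_indicator[symmetric]
      nn_integral_count_space_finite)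
qed (use assms in auto)

text \<open>As an integral in which failure counts 0, the expectation admits the change of variables
  for image measures.\<close>

lemma expect_eq:
  fixes M :: "('n::finite) state measure"
  assumes "disc_measure M"
  shows "expect M f = (\<integral>\<^sup>+ s. (case s of None \<Rightarrow> 0 | Some x \<Rightarrow> ennreal (f x)) \<partial>M)"
proof -
  let ?h = "\<lambda>s :: 'n state. case s of None \<Rightarrow> 0 | Some x \<Rightarrow> ennreal (f x)"
  have "(\<integral>\<^sup>+ s. ?h s \<partial>M) = (\<integral>\<^sup>+ s. emeasure M {s} * ?h s \<partial>count_space UNIV)"
    by (subst disc_measure_eq_density[OF assms], subst nn_integral_density) auto
  also have "\<dots> = (\<integral>\<^sup>+ s. emeasure M {s} * ?h s * indicator (range Some) s \<partial>count_space UNIV)"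
    by (intro nn_integral_cong) (auto split: option.split simp: indicator_def)
  also have "\<dots> = (\<integral>\<^sup>+ s. emeasure M {s} * ?h s \<partial>count_space (range Some))"
    by (subst nn_integral_count_space_indicator) auto
  also have "\<dots> = expect M f"
    unfolding expect_def
    by (subst nn_integral_bij_count_space[where g = Some and A = UNIV, symmetric])
      (auto simp: bij_betw_def)
  finally show ?thesis ..
qed

text \<open>\<open>map_option g\<close> fixes the failure state, so the two summands of an
  assignment clause together form one image measure.\<close>

lemma disc_push_eq_distr:
  assumes "disc_measure M"
  shows "disc (\<lambda>S. emeasure (on_fail M) S + emeasure M {Some x | x. Some (g x) \<in> S})
    = distr M (count_space UNIV) (map_option g)"
proof (rule measure_eqI)
  fix S :: "'a state set"
  have "map_option g -` S = ({None} \<inter> S) \<union> {Some x | x. Some (g x) \<in> S}"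
  proof (intro set_eqI)
    fix s show "s \<in> map_option g -` S \<longleftrightarrow> s \<in> ({None} \<inter> S) \<union> {Some x | x. Some (g x) \<in> S}"
      by (cases s) auto
  qed
  moreover have "emeasure M (({None} \<inter> S) \<union> {Some x | x. Some (g x) \<in> S})
      = emeasure M ({None} \<inter> S) + emeasure M {Some x | x. Some (g x) \<in> S}"
    using assms by (intro plus_emeasure[symmetric]) auto
  moreover have "emeasure (distr M (count_space UNIV) (map_option g)) S = emeasure M (map_option g -` S)"
    using assms by (subst emeasure_distr) (auto simp: space_disc_measure measurable_def)
  ultimately show "emeasure (disc (\<lambda>S. emeasure (on_fail M) S + emeasure M {Some x | x. Some (g x) \<in> S})) S
      = emeasure (distr M (count_space UNIV) (map_option g)) S"
    unfolding emeasure_disc_push[OF assms] using assms by (simp add: emeasure_restr)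
qed simp

lemma expect_distr:
  fixes M :: "('n::finite) state measure" and g :: "('n \<Rightarrow> nat) \<Rightarrow> 'n \<Rightarrow> nat"
  assumes "disc_measure M"
  shows "expect (distr M (count_space UNIV) (map_option g)) f = expect M (\<lambda>x. f (g x))"
proof -
  have g: "map_option g \<in> measurable M (count_space UNIV)"
    using assms by (auto simp: space_disc_measure measurable_def)
  have "disc_measure (distr M (count_space UNIV) (map_option g))" by simp
  then show ?thesis
    unfolding expect_eq[OF assms]
    by (auto simp: expect_eq nn_integral_distr[OF g] intro!: nn_integral_cong split: option.split)
qed

section \<open>Events as densities\<close>

lemma measurable_disc: "disc_measure M \<Longrightarrow> f \<in> measurable M (count_space UNIV)"
  by (simp add: measurable_def space_disc_measure)

lemma borel_measurable_disc: "disc_measure M \<Longrightarrow> f \<in> borel_measurable M"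
  by (simp add: measurable_def space_disc_measure)

lemma emeasure_density_point:
  assumes "disc_measure M"
  shows "emeasure (density M h) {s} = h s * emeasure M {s}"
proof -
  have "emeasure (density M h) {s} = (\<integral>\<^sup>+ t. h t * indicator {s} t \<partial>M)"
    using assms by (intro emeasure_density borel_measurable_disc) auto
  also have "\<dots> = (\<integral>\<^sup>+ t. h s * indicator {s} t \<partial>M)"
    by (intro nn_integral_cong) (auto simp: indicator_def)
  also have "\<dots> = h s * emeasure M {s}"
    using assms by (intro nn_integral_cmult_indicator) auto
  finally show ?thesis .
qed

lemma emeasure_density_le:
  assumes "disc_measure M" "\<And>s. h s \<le> h' s"
  shows "emeasure (density M h) S \<le> emeasure (density M h') S"
  using assms by (simp add: emeasure_density borel_measurable_disc)
    (intro nn_integral_mono mult_right_mono, auto)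

lemma emeasure_density_le_measure:
  assumes "disc_measure M" "\<And>s. h s \<le> 1"
  shows "emeasure (density M h) S \<le> emeasure M S"
  using emeasure_density_le[of M h "\<lambda>_. 1" S] assms by (simp add: density_1)

abbreviation opt_prob :: "'n event \<Rightarrow> 'n state \<Rightarrow> ennreal" where
  "opt_prob E s \<equiv> case s of None \<Rightarrow> 0 | Some x \<Rightarrow> ennreal (ev_prob E x)"

lemma opt_prob_le_1: "wf_event E \<Longrightarrow> opt_prob E s \<le> 1"
  by (auto simp: ev_prob_bounds split: option.split)

text \<open>Finiteness turns the difference of measures in the negation clause into a subtraction of
  densities.\<close>

lemma event_sem_eq_density:
  fixes M :: "('n::finite) state measure"
  assumes "disc_measure M" "emeasure M UNIV < \<infinity>" "wf_event E"
  shows "event_sem E M = density M (opt_prob E)"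
  using assms
proof (induction E arbitrary: M)
  case (VarEq k a)
  show ?case
  proof (rule measure_eqI_countable[where A = UNIV])
    fix s
    have "{Some x | x. Some x \<in> {s} \<and> x k = a}
        = (case s of None \<Rightarrow> {} | Some x \<Rightarrow> if x k = a then {Some x} else {})"
      by (auto split: option.splits)
    then show "emeasure (event_sem (VarEq k a) M) {s} = emeasure (density M (opt_prob (VarEq k a))) {s}"
      unfolding emeasure_event_VarEq[OF VarEq(1)] emeasure_density_point[OF VarEq(1)]
      by (auto split: option.splits)
  qed (use VarEq in auto)
next
  case (Flip \<rho>)
  show ?case
  proof (rule measure_eqI_countable[where A = UNIV])
    fix s :: "'n state"
    have "range Some \<inter> {s} = (case s of None \<Rightarrow> {} | Some x \<Rightarrow> {s})"
      by (auto split: option.splits)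
    then show "emeasure (event_sem (Flip \<rho>) M) {s} = emeasure (density M (opt_prob (Flip \<rho>))) {s}"
      unfolding emeasure_density_point[OF Flip(1)] using Flip(1)
      by (auto simp: emeasure_restr split: option.splits)
  qed (use Flip in auto)
next
  case (Neg E)
  have wf: "wf_event E" using Neg.prems by simp
  have IH: "event_sem E M = density M (opt_prob E)" by (rule Neg.IH[OF Neg.prems(1,2) wf])
  have le: "opt_prob E s \<le> indicator (range Some) s" for s
    using ev_prob_bounds[OF wf] by (auto split: option.splits simp: indicator_def)
  have fin: "finite_measure (density M h)" if "\<And>s. h s \<le> 1" for h
  proof (rule finite_measureI)
    have "emeasure (density M h) UNIV \<le> emeasure M UNIV"
      by (rule emeasure_density_le_measure[OF Neg.prems(1) that])
    with Neg.prems show "emeasure (density M h) (space (density M h)) \<noteq> \<infinity>"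
      by (auto simp: space_disc_measure top_unique)
  qed
  show ?case
  proof (rule measure_eqI_countable[where A = UNIV])
    fix s
    have ne: "emeasure M {s} \<noteq> \<infinity>"
      using Neg.prems emeasure_mono[of "{s}" UNIV M] by (auto simp: top_unique)
    have "emeasure (event_sem (Neg E) M) {s}
        = emeasure (on_nat M) {s} - emeasure (density M (opt_prob E)) {s}"
      unfolding event_sem.simps IH
    proof (rule emeasure_diff_measure)
      show "emeasure (density M (opt_prob E)) A \<le> emeasure (on_nat M) A" for A
        unfolding restr_def by (rule emeasure_density_le[OF Neg.prems(1) le])
      show "finite_measure (on_nat M)" unfolding restr_def by (rule fin) (simp add: indicator_def)
      show "finite_measure (density M (opt_prob E))" by (rule fin) (rule opt_prob_le_1[OF wf])
    qed (use Neg.prems in auto)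
    also have "\<dots> = indicator (range Some) s * emeasure M {s} - opt_prob E s * emeasure M {s}"
      unfolding restr_def emeasure_density_point[OF Neg.prems(1)] ..
    also have "\<dots> = opt_prob (Neg E) s * emeasure M {s}"
    proof (cases s)
      case (Some x)
      obtain m where m: "emeasure M {s} = ennreal m" "0 \<le> m"
        using ne by (cases "emeasure M {s}") auto
      have "ennreal m - ennreal (ev_prob E x) * ennreal m = ennreal (m - ev_prob E x * m)"
        using m(2) ev_prob_bounds[OF wf, of x]
        by (simp add: ennreal_mult[symmetric] ennreal_minus[symmetric])
      also have "\<dots> = ennreal (1 - ev_prob E x) * ennreal m"
        using m(2) ev_prob_bounds[OF wf, of x]
        by (simp add: ennreal_mult[symmetric] left_diff_distrib)
      finally show ?thesis using Some m by simp
    qed simp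
    finally show "emeasure (event_sem (Neg E) M) {s} = emeasure (density M (opt_prob (Neg E))) {s}"
      unfolding emeasure_density_point[OF Neg.prems(1)] .
  qed (use Neg.prems in auto)
next
  case (Conj E1 E2)
  have wf: "wf_event E1" "wf_event E2" using Conj.prems by auto
  let ?N = "density M (opt_prob E1)"
  have N: "disc_measure ?N" using Conj.prems by simp
  have "emeasure ?N UNIV \<le> emeasure M UNIV"
    by (rule emeasure_density_le_measure[OF Conj.prems(1) opt_prob_le_1[OF wf(1)]])
  with Conj.prems have "emeasure ?N UNIV < \<infinity>" by simp
  then have "event_sem (Conj E1 E2) M = density ?N (opt_prob E2)"
    using Conj.IH(1)[OF Conj.prems(1,2) wf(1)] Conj.IH(2)[OF N _ wf(2)] by simp
  also have "\<dots> = density M (opt_prob (Conj E1 E2))"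
  proof (rule measure_eqI_countable[where A = UNIV])
    fix s
    show "emeasure (density ?N (opt_prob E2)) {s} = emeasure (density M (opt_prob (Conj E1 E2))) {s}"
      unfolding emeasure_density_point[OF Conj.prems(1)] emeasure_density_point[OF N]
      using ev_prob_bounds[OF wf(1)] ev_prob_bounds[OF wf(2)]
      by (auto split: option.split simp: ennreal_mult mult_ac)
  qed (use Conj.prems in auto)
  finally show ?case .
qed

text \<open>Weakest preexpectation: the expected value of \<open>f\<close> after a run from
  \<open>x\<close>, where failing runs count 0. In contrast to \<open>drift\<close>, it accounts for
  truncated decrements.\<close>

primrec wp :: "'n prog \<Rightarrow> (('n \<Rightarrow> nat) \<Rightarrow> real) \<Rightarrow> ('n \<Rightarrow> nat) \<Rightarrow> real" where
  "wp Skip f = f"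
| "wp (Seq P1 P2) f = wp P1 (wp P2 f)"
| "wp (SetZero k) f = (\<lambda>_. 0)"
| "wp (Inc k a) f = (\<lambda>x. f (x(k := x k + a)))"
| "wp (Dec k) f = (\<lambda>x. f (x(k := x k - 1)))"
| "wp (Ite E P1 P2) f
     = (\<lambda>x. case E of Flip \<rho> \<Rightarrow> \<rho> * wp P1 f x + (1 - \<rho>) * wp P2 f x | _ \<Rightarrow> 0)"
| "wp (While E P) f = (\<lambda>_. 0)"
| "wp Fail f = (\<lambda>_. 0)"

lemma wp_nonneg:
  assumes "simple_body B" "wf_prog B" "\<And>x. 0 \<le> f x"
  shows "0 \<le> wp B f x"
  using assms by (induction arbitrary: f x rule: simple_body.induct) auto

lemma wp_mono:
  assumes "simple_body B" "wf_prog B" "\<And>x. f x \<le> g x"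
  shows "wp B f x \<le> wp B g x"
  using assms by (induction arbitrary: f g x rule: simple_body.induct)
    (auto intro!: add_mono mult_left_mono)

abbreviation dot :: "('n::finite \<Rightarrow> real) \<Rightarrow> ('n \<Rightarrow> nat) \<Rightarrow> real" where
  "dot l x \<equiv> \<Sum>i\<in>UNIV. l i * real (x i)"

lemma dot_update: "dot l (x(k := j)) = dot l x + l k * (real j - real (x k))"
proof -
  have "dot l (x(k := j)) = l k * real j + (\<Sum>i\<in>UNIV - {k}. l i * real (x i))"
    by (subst sum.remove[of _ k]) auto
  moreover have "dot l x = l k * real (x k) + (\<Sum>i\<in>UNIV - {k}. l i * real (x i))"
    by (subst sum.remove[of _ k]) auto
  ultimately show ?thesis by (simp add: algebra_simps)
qed

text \<open>The inequality is strict only where a decrement is truncated.\<close>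

lemma wp_affine_ge:
  fixes l :: "'n::finite \<Rightarrow> real"
  assumes "simple_body B" "wf_prog B" "\<And>k. 0 \<le> l k" "0 \<le> u"
  shows "survival B * (u * dot l x + t) + u * drift l B \<le> wp B (\<lambda>x. u * dot l x + t) x"
  using assms
proof (induction arbitrary: u t x rule: simple_body.induct)
  case (1 k)
  show ?case unfolding wp.simps dot_update by (simp add: algebra_simps)
next
  case (2 k)
  \<comment> \<open>Truncation changes \<open>X_k\<close> by 0 instead of -1, which can only raise a
    linear function with nonnegative coefficients.\<close>
  have "- 1 \<le> real (x k - 1) - real (x k)" by linarith
  then have "u * l k * - 1 \<le> u * l k * (real (x k - 1) - real (x k))"
    using 2 by (intro mult_left_mono) auto
  then show ?case unfolding wp.simps dot_update by (simp add: algebra_simps)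
next
  case 3
  then show ?case by simp
next
  case (4 P1 P2 \<rho>)
  let ?f = "\<lambda>x. u * dot l x + t"
  have "\<rho> * (survival P1 * ?f x + u * drift l P1) \<le> \<rho> * wp P1 ?f x"
    using 4 by (intro mult_left_mono) auto
  moreover have "(1 - \<rho>) * (survival P2 * ?f x + u * drift l P2) \<le> (1 - \<rho>) * wp P2 ?f x"
    using 4 by (intro mult_left_mono) auto
  ultimately show ?case by (simp add: algebra_simps)
next
  case (5 P1 P2)
  let ?f = "\<lambda>x. u * dot l x + t"
  \<comment> \<open>The lower bound for \<open>P2\<close> is again affine in the state, with slope
    \<open>?u\<close> and intercept \<open>?t\<close>. The claim is stated for all \<open>u\<close>
    and \<open>t\<close> so that the bound for \<open>P1\<close> applies to it.\<close>
  let ?u = "survival P2 * u" and ?t = "survival P2 * t + u * drift l P2"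
  have wf: "wf_prog P1" "wf_prog P2" using 5 by auto
  have "0 \<le> ?u" using 5 survival_bounds(1)[OF 5(2) wf(2)] by simp
  then have "survival P1 * (?u * dot l x + ?t) + ?u * drift l P1 \<le> wp P1 (\<lambda>x. ?u * dot l x + ?t) x"
    using 5(3) wf 5(6) by blast
  also have "\<dots> \<le> wp P1 (wp P2 ?f) x"
  proof (rule wp_mono[OF 5(1) wf(1)])
    fix y
    show "?u * dot l y + ?t \<le> wp P2 ?f y"
      using 5(4)[OF wf(2) 5(6,7), of y t] by (simp add: algebra_simps)
  qed
  finally show ?case by (simp add: algebra_simps)
qed

text \<open>Finite mass is carried through the induction because branching is evaluated by
  densities. Nonnegative \<open>f\<close> is needed since \<open>ennreal\<close> would cut off
  negative values and destroy additivity.\<close>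

lemma expect_prog_sem:
  fixes M :: "('n::finite) state measure"
  assumes "simple_body B" "wf_prog B" "disc_measure M" "emeasure M UNIV < \<infinity>" "\<And>x. 0 \<le> f x"
  shows "expect (prog_sem B M) f = expect M (wp B f) \<and> emeasure (prog_sem B M) UNIV < \<infinity>"
  using assms
proof (induction arbitrary: M f rule: simple_body.induct)
  case (1 k)
  show ?case
    unfolding prog_sem.simps disc_push_eq_distr[OF 1(2)] expect_distr[OF 1(2)]
    using 1 by (simp add: emeasure_distr measurable_disc space_disc_measure)
next
  case (2 k)
  show ?case
    unfolding prog_sem.simps disc_push_eq_distr[OF 2(2)] expect_distr[OF 2(2)]
    using 2 by (simp add: emeasure_distr measurable_disc space_disc_measure)
next
  case 3
  then show ?case by (simp add: expect_def)
next
  case (4 P1 P2 \<rho>)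
  let ?E = "Flip \<rho> :: 'n event"
  have wf: "wf_prog P1" "wf_prog P2" "wf_event ?E" "wf_event (Neg ?E)" using 4(5) by auto
  have \<rho>: "0 \<le> \<rho>" "\<rho> \<le> 1" using wf(3) by auto
  define M1 where "M1 = event_sem ?E M"
  define M2 where "M2 = event_sem (Neg ?E) M"
  have eq: "M1 = density M (opt_prob ?E)" "M2 = density M (opt_prob (Neg ?E))"
    unfolding M1_def M2_def by (rule event_sem_eq_density[OF 4(6,7)], fact)+
  have d: "disc_measure M1" "disc_measure M2" using 4(6) by (auto simp: eq)
  have "emeasure M1 UNIV \<le> emeasure M UNIV" "emeasure M2 UNIV \<le> emeasure M UNIV"
    unfolding eq by (rule emeasure_density_le_measure[OF 4(6) opt_prob_le_1], fact)+
  then have fin: "emeasure M1 UNIV < \<infinity>" "emeasure M2 UNIV < \<infinity>" using 4(7) by auto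
  have IH: "expect (prog_sem P1 M1) f = expect M1 (wp P1 f)" "emeasure (prog_sem P1 M1) UNIV < \<infinity>"
    "expect (prog_sem P2 M2) f = expect M2 (wp P2 f)" "emeasure (prog_sem P2 M2) UNIV < \<infinity>"
    using 4(3)[OF wf(1) d(1) fin(1) 4(8)] 4(4)[OF wf(2) d(2) fin(2) 4(8)] by auto
  have dd: "disc_measure (on_fail M)" "disc_measure (prog_sem P1 M1)" "disc_measure (prog_sem P2 M2)"
    using 4(6) d by (auto simp: disc_measure_prog_sem)
  let ?D = "disc (\<lambda>S. emeasure (on_fail M) S + emeasure (prog_sem P1 M1) S)"
  have em: "emeasure (prog_sem (Ite ?E P1 P2) M) S
      = emeasure (on_fail M) S + emeasure (prog_sem P1 M1) S + emeasure (prog_sem P2 M2) S" for S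
    using emeasure_disc_add[of ?D "prog_sem P2 M2" S] emeasure_disc_add[OF dd(1,2)] dd(3)
    by (simp add: M1_def M2_def del: event_sem.simps)
  have nonneg: "0 \<le> wp P1 f x" "0 \<le> wp P2 f x" for x
    using wp_nonneg[OF 4(1) wf(1) 4(8)] wp_nonneg[OF 4(2) wf(2) 4(8)] by auto
  have "expect (prog_sem (Ite ?E P1 P2) M) f = expect (prog_sem P1 M1) f + expect (prog_sem P2 M2) f"
    unfolding expect_def em using 4(6)
    by (subst nn_integral_add[symmetric]) (auto simp: emeasure_restr distrib_right)
  also have "\<dots> = expect M1 (wp P1 f) + expect M2 (wp P2 f)" using IH by simp
  also have "\<dots> = expect M (wp (Ite ?E P1 P2) f)"
    unfolding expect_def eq emeasure_density_point[OF 4(6)]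
    using \<rho> nonneg
    by (subst nn_integral_add[symmetric])
      (auto intro!: nn_integral_cong simp: ennreal_plus ennreal_mult distrib_left mult_ac)
  finally have 1: "expect (prog_sem (Ite ?E P1 P2) M) f = expect M (wp (Ite ?E P1 P2) f)" .
  have "emeasure (on_fail M) UNIV \<le> emeasure M UNIV"
    using 4(6) by (auto simp: emeasure_restr intro!: emeasure_mono)
  then have "emeasure (prog_sem (Ite ?E P1 P2) M) UNIV < \<infinity>"
    unfolding em using IH(2,4) 4(7) by (auto simp: less_top)
  with 1 show ?case by blast
next
  case (5 P1 P2)
  have wf: "wf_prog P1" "wf_prog P2" using 5(5) by auto
  have fin: "emeasure (prog_sem P1 M) UNIV < \<infinity>" using 5(3)[OF wf(1) 5(6,7,8)] by auto
  note IH2 = 5(4)[OF wf(2) disc_measure_prog_sem[OF 5(6)] fin 5(8)]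
  have "\<And>x. 0 \<le> wp P2 f x" using wp_nonneg[OF 5(2) wf(2) 5(8)] by auto
  from 5(3)[OF wf(1) 5(6,7) this] IH2 show ?case by simp
qed

section \<open>Existence of a geometric loop bound\<close>

lemma ev_prob_eq_0:
  fixes E :: "'n::finite event"
  assumes "wf_event E" "event_sem E (dirac x) = null_measure (count_space UNIV)"
  shows "ev_prob E x = 0"
proof -
  have "emeasure (event_sem E (dirac x)) {Some x} = ennreal (ev_prob E x)"
    using event_sem_eq_density[of "dirac x" E] assms(1)
    by (simp add: dirac_def emeasure_density_point)
  with assms show ?thesis using ev_prob_bounds[OF assms(1), of x] by simp
qed

lemma event_sem_dirac_certain:
  fixes E :: "'n::finite event"
  assumes "wf_event E" "ev_prob E x = 1"
  shows "event_sem E (dirac x) = dirac x"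
proof (rule measure_eqI_countable[where A = UNIV])
  fix s :: "'n state"
  show "emeasure (event_sem E (dirac x)) {s} = emeasure (dirac x) {s}"
    using event_sem_eq_density[of "dirac x" E] assms
    by (auto simp: dirac_def emeasure_density_point indicator_def)
qed (auto simp: dirac_def disc_measure_event_sem)

text \<open>A certain event leaves \<open>dirac x\<close> unchanged, so the assumption reads
  \<open>wp B (dot l) x < dot l x\<close>. The lower bound \<open>dot l x + drift l B\<close> on the
  left side then gives the sign of the drift.\<close>

lemma drift_neg_of_expect_less:
  fixes E :: "'n::finite event"
  assumes wf: "wf_event E" "wf_prog B" and B: "simple_body B" and l: "\<And>i. 0 \<le> l i"
    and certain: "ev_prob E x = 1" "survival B = 1"
    and less: "expect (nat_sem B (event_sem E (dirac x))) (dot l) < ennreal (dot l x)"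
  shows "drift l B < 0"
proof -
  have nonneg: "0 \<le> dot l y" for y :: "'n \<Rightarrow> nat" using l by (intro sum_nonneg) auto
  have d: "disc_measure (dirac x)" "emeasure (dirac x) UNIV < \<infinity>" by (auto simp: dirac_def)
  have "emeasure (nat_sem B (dirac x)) {Some y} = emeasure (prog_sem B (dirac x)) {Some y}" for y
  proof -
    have "range Some \<inter> {Some y} = {Some y}" by auto
    then show ?thesis
      using disc_measure_prog_sem[OF d(1), of B] by (simp add: nat_sem_def emeasure_restr)
  qed
  then have "expect (nat_sem B (dirac x)) (dot l) = expect (prog_sem B (dirac x)) (dot l)"
    by (simp add: expect_def)
  also have "\<dots> = expect (dirac x) (wp B (dot l))"
    using expect_prog_sem[OF B wf(2) d, of "dot l"] nonneg by blast
  also have "\<dots> = ennreal (wp B (dot l) x)"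
    unfolding expect_eq[OF d(1)] by (simp add: dirac_def nn_integral_return)
  finally have "ennreal (wp B (dot l) x) < ennreal (dot l x)"
    using less event_sem_dirac_certain[OF wf(1) certain(1)] by simp
  then have "wp B (dot l) x < dot l x"
    using wp_nonneg[OF B wf(2), of "dot l" x] nonneg by (simp add: ennreal_less_iff)
  moreover have "dot l x + drift l B \<le> wp B (dot l) x"
    using wp_affine_ge[where l = l and u = 1 and t = 0, OF B wf(2) l] certain by simp
  ultimately show ?thesis by simp
qed

theorem theorem4p15:
  fixes E :: "'n::finite event" and B :: "'n prog" and coef :: "'n \<Rightarrow> real"
  assumes "wf_prog (While E B)"
    and "simple_body B"
    and "\<And>x i. x i < max_decs B i \<Longrightarrow> event_sem E (dirac x) = null_measure (count_space UNIV)"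
    and "\<And>i. 0 \<le> coef i"
    and "\<And>x. (\<And>i. max_decs B i \<le> x i) \<Longrightarrow>
           expect (nat_sem B (event_sem E (dirac x))) (\<lambda>y. \<Sum>i\<in>UNIV. coef i * real (y i))
             < ennreal (\<Sum>i\<in>UNIV. coef i * real (x i))"
  shows "\<forall>p\<in>egds. \<exists>q\<in>egds. geo_sem (While E B) p q"
proof
  have wf: "wf_event E" "wf_prog B" using assms(1) by auto
  note B = assms(2)
  define \<rho> where "\<rho> = Max (range (ev_prob E))"
  have \<rho>: "\<rho> \<in> range (ev_prob E)" "\<And>x. ev_prob E x \<le> \<rho>"
    unfolding \<rho>_def using finite_range_ev_prob[of E] by (auto intro: Max_in)
  have \<rho>01: "0 \<le> \<rho>" "\<rho> \<le> 1" using \<rho>(1) ev_prob_bounds[OF wf(1)] by auto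
  have supp: "max_decs B \<le> x" if "ev_prob E x \<noteq> 0" for x
  proof (rule le_funI, rule ccontr)
    fix i assume "\<not> max_decs B i \<le> x i"
    then have "x i < max_decs B i" by simp
    then have "event_sem E (dirac x) = null_measure (count_space UNIV)" by (rule assms(3))
    with ev_prob_eq_0[OF wf(1)] that show False by blast
  qed
  have "\<rho> * survival B < 1 \<or> (survival B = 1 \<and> drift coef B < 0)"
  proof (cases "\<rho> * survival B < 1")
    case False
    note s = survival_bounds[OF B wf(2)]
    \<comment> \<open>Two factors in the unit interval whose product is not below 1 are both 1. The
      state \<open>x\<close> attaining \<open>\<rho>\<close> lies above \<open>max_decs B\<close> by
      \<open>supp\<close>, so the ranking inequality applies to it.\<close>
    have "\<rho> * survival B \<le> \<rho> * 1" "\<rho> * survival B \<le> 1 * survival B"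
      using s \<rho>01 by (intro mult_left_mono mult_right_mono; simp)+
    with False s \<rho>01 have 1: "\<rho> = 1" "survival B = 1" by auto
    with \<rho>(1) obtain x where x: "ev_prob E x = 1" by auto
    have "max_decs B i \<le> x i" for i using supp[of x] x by (simp add: le_fun_def)
    from drift_neg_of_expect_less[where l = coef, OF wf B assms(4) x 1(2) assms(5)[OF this]] 1 show ?thesis by simp
  qed simp
  then obtain l where l: "\<And>k. 0 < l k"
    and ev: "eventually (\<lambda>e. \<rho> * weight (\<lambda>k. exp (- (e * l k))) B < 1) (at_right 0)"
    using eventually_weight_less_1[where l = coef, OF B assms(4) \<rho>01(2) _ \<rho>01(1)] by blast
  fix p :: "'n egd" assume p: "p \<in> egds"
  obtain P \<alpha> where P: "p = (P, \<alpha>)" by (cases p)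
  have \<alpha>: "0 \<le> \<alpha> k" "\<alpha> k < 1" for k using p by (auto simp: P egds_def)
  \<comment> \<open>As \<open>e\<close> tends to 0 the rates tend to 1, which exceeds each of the
    finitely many \<open>\<alpha> k\<close>.\<close>
  have "eventually (\<lambda>e. \<alpha> k < exp (- (e * l k))) (at_right 0)" for k
  proof (rule order_tendstoD(1))
    have "((\<lambda>e. exp (- (e * l k))) \<longlongrightarrow> exp (- (0 * l k))) (at_right 0)" by (intro tendsto_intros)
    then show "((\<lambda>e. exp (- (e * l k))) \<longlongrightarrow> 1) (at_right 0)" by simp
  qed (rule \<alpha>)
  then have "eventually (\<lambda>e. \<forall>k. \<alpha> k < exp (- (e * l k))) (at_right 0)"
    by (rule eventually_all_finite)
  with ev have "eventually (\<lambda>e. 0 < e \<and> \<rho> * weight (\<lambda>k. exp (- (e * l k))) B < 1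
      \<and> (\<forall>k. \<alpha> k < exp (- (e * l k)))) (at_right 0)"
    by (intro eventually_conj eventually_at_right_less)
  from eventually_happens'[OF _ this] obtain e where e: "0 < e"
    "\<rho> * weight (\<lambda>k. exp (- (e * l k))) B < 1" "\<And>k. \<alpha> k < exp (- (e * l k))" by auto
  define \<gamma> where "\<gamma> = (\<lambda>k. exp (- (e * l k)))"
  have \<gamma>: "0 < \<gamma> k \<and> \<gamma> k < 1" "\<alpha> k < \<gamma> k" for k using e l by (auto simp: \<gamma>_def)
  have geo_pos: "0 < geo \<gamma> i" for i using \<gamma>(1) by (intro prod_pos) simp
  define c where "c = \<rho> * weight \<gamma> B"
  have c: "0 \<le> c" "c < 1"
    using e(2) weight_nonneg[OF B wf(2), of \<gamma>] \<gamma>(1) \<rho>01 by (auto simp: c_def \<gamma>_def less_imp_le)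
  define I where "I = {i :: 'n \<Rightarrow> nat. \<forall>k. i k < tsize P k}"
  have "I = PiE UNIV (\<lambda>k. {..<tsize P k})" by (auto simp: I_def PiE_def)
  then have I: "finite I" by (simp add: finite_PiE)
  \<comment> \<open>The sum bounds each single ratio \<open>mass p i / geo \<gamma> i\<close> in the
    box. The box is enough, because \<open>le_egd\<close> compares masses only below the larger of
    the two sizes.\<close>
  define C where "C = (\<Sum>i\<in>I. mass p i / geo \<gamma> i)"
  have C: "0 \<le> C" unfolding C_def
    using geo_pos by (intro sum_nonneg divide_nonneg_pos mass_nonneg p)
  define R :: "'n tensor" where "R = tensor (\<lambda>_. 1) (\<lambda>_. C)"
  have tR: "tsize R = (\<lambda>_. 1)" by (simp add: R_def tsize_tensor)
  have mR: "mass (R, \<gamma>) i = C * geo \<gamma> i" for i unfolding R_def by (subst mass_tensor) auto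
  have R: "(R, \<gamma>) \<in> egds" unfolding R_def using C \<gamma>(1) by (intro egds_tensorI) (auto intro: less_imp_le)
  have le1: "le_egd p (R, \<gamma>)"
  proof -
    have "mass p i \<le> C * geo \<gamma> i" if "\<forall>k. i k < max (tsize P k) (tsize R k)" for i
    proof -
      have "i k < tsize P k" for k
        using that[rule_format, of k] tsize_pos[of P k] unfolding tR by linarith
      then have "i \<in> I" by (simp add: I_def)
      then have "mass p i / geo \<gamma> i \<le> C" unfolding C_def
        using I geo_pos by (intro member_le_sum divide_nonneg_pos mass_nonneg p)
      then show ?thesis using geo_pos[of i] by (simp add: pos_divide_le_eq del: mass.simps)
    qed
    then show ?thesis using \<gamma>(2) by (auto simp: P mR le_fun_def less_imp_le simp del: mass.simps)
  qed
  have ex: "geo_event E (R, \<gamma>) \<in> egds" "\<And>i. mass (geo_event E (R, \<gamma>)) i = ev_prob E i * mass (R, \<gamma>) i"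
    using geo_event_exact[OF wf(1) R] by auto
  have "geo_bounded \<gamma> (\<lambda>_. 0) C (R, \<gamma>)"
    using R by (simp add: geo_bounded_def mR le_fun_def del: mass.simps)
  from geo_bounded_event[OF wf(1) this \<rho>(2)]
  \<comment> \<open>The guard raises the lower bound on the support from 0 to
    \<open>max_decs B\<close>, since \<open>E\<close> has probability 0 in all other states.\<close>
  have bounded: "geo_bounded \<gamma> (max_decs B) (\<rho> * C) (geo_event E (R, \<gamma>))"
    using supp ex by (auto simp: geo_bounded_def simp del: mass.simps)
  have decs: "count_list \<pi> (Dec k) \<le> max_decs B k" if "\<pi> \<in> paths B" for \<pi> k
    unfolding max_decs_def using that finite_paths_simple_body[OF B] by (intro Max_ge) auto
  \<comment> \<open>No path decrements \<open>X_k\<close> more than \<open>max_decs B k\<close>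
    times, so the lower bound 0 remains after the body.\<close>
  have "\<exists>s. geo_sem B (geo_event E (R, \<gamma>)) s \<and> geo_bounded \<gamma> (\<lambda>_. 0) (\<rho> * C * weight \<gamma> B) s"
    by (rule geo_sem_simple_body[OF B wf(2) \<gamma>(1) bounded]) (auto intro: decs)
  then obtain s where s: "geo_sem B (geo_event E (R, \<gamma>)) s"
    "geo_bounded \<gamma> (\<lambda>_. 0) (\<rho> * C * weight \<gamma> B) s"
    by blast
  have le2: "le_egd s (smult_tensor c R, \<gamma>)"
  proof -
    have "mass s i \<le> mass (smult_tensor c R, \<gamma>) i" for i
      using s(2) unfolding mass_smult mR by (simp add: geo_bounded_def c_def mult_ac)
    with s(2) show ?thesis by (cases s) (auto simp: geo_bounded_def simp del: mass.simps)
  qed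
  let ?q = "geo_event (Neg E) (smult_tensor (1 / (1 - c)) R, \<gamma>)"
  have "?q \<in> egds"
    using geo_event_exact[of "Neg E" "(smult_tensor (1 / (1 - c)) R, \<gamma>)"] smult_egds[OF R] wf c by auto
  moreover have "geo_sem (While E B) p ?q"
    unfolding geo_sem.simps using R s c le1 le2 by (auto simp: geo_bounded_def simp del: le_egd.simps)
  ultimately show "\<exists>q\<in>egds. geo_sem (While E B) p q" by blast
qed

end
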